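(* Let $A$ be a short local algebra and $M$ a non-projective semi-Gorenstein-projective $A$-module. Then $\operatorname{Ext}^1_A(M,M)\ne0$. Moreover, if $A$ is not self-injective, then $\operatorname{Ext}^i_A(M,M)\ne0$ for all $i\ge1$.
   Context: Let $k$ be a field. All algebras $A$ are finite-dimensional local (not necessarily commutative) $k$-algebras with radical $J$ such that $A/J=k$. $A$ is short if $J^3=0$. Modules are left $A$-modules of finite length. $A$ is self-injective if ${}_AA$ is injective. A module $M$ is semi-Gorenstein-projective if $\operatorname{Ext}^i_A(M,A)=0$ for all $i\ge1$. *)

theory Defs
  imports
    Complex_Main
    "HOL-Library.Function_Algebras"
    "HOL-Algebra.Elementary_Groups"
begin

section \<open>Left modules over a (not necessarily commutative) ring\<close>

text \<open>
  HOL.Modules and HOL-Algebra only provide modules over commutative rings. Here a left module over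
  a ring 'a is a type 'm of class ab_group_add together with an action of 'a on it.
\<close>

locale left_module =
  fixes act :: "'a::ring_1 \<Rightarrow> 'm::ab_group_add \<Rightarrow> 'm"
  assumes act_add_right: "act a (x + y) = act a x + act a y"
    and act_add_left: "act (a + b) x = act a x + act b x"
    and act_act: "act a (act b x) = act (a * b) x"
    and act_one: "act 1 x = x"

definition submod :: "('a::ring_1 \<Rightarrow> 'm::ab_group_add \<Rightarrow> 'm) \<Rightarrow> 'm set \<Rightarrow> bool" where
  "submod act S \<longleftrightarrow>
     0 \<in> S \<and> (\<forall>x\<in>S. \<forall>y\<in>S. x + y \<in> S) \<and> (\<forall>a. \<forall>x\<in>S. act a x \<in> S)"

text \<open>Finite length: existence of a composition series.\<close>

definition finite_length :: "('a::ring_1 \<Rightarrow> 'm::ab_group_add \<Rightarrow> 'm) \<Rightarrow> bool" where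
  "finite_length act \<longleftrightarrow>
     (\<exists>(n::nat) C. C 0 = {0} \<and> C n = UNIV \<and> (\<forall>i\<le>n. submod act (C i)) \<and>
        (\<forall>i<n. C i \<subset> C (Suc i) \<and>
           \<not> (\<exists>S. submod act S \<and> C i \<subset> S \<and> S \<subset> C (Suc i))))"

text \<open>
  Homomorphisms from the module on the carrier X to the module on the carrier Y. They are extended
  by 0 outside X, so that equality of homomorphisms is equality of functions and the homomorphisms
  form a subgroup of the additive group of all functions.
\<close>

definition hom_on ::
  "'b::ab_group_add set \<Rightarrow> ('a::ring_1 \<Rightarrow> 'b \<Rightarrow> 'b) \<Rightarrow>
   'c::ab_group_add set \<Rightarrow> ('a \<Rightarrow> 'c \<Rightarrow> 'c) \<Rightarrow> ('b \<Rightarrow> 'c) set" where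
  "hom_on X actX Y actY =
     {f. (\<forall>x\<in>X. f x \<in> Y) \<and> (\<forall>x\<in>X. \<forall>y\<in>X. f (x + y) = f x + f y) \<and>
         (\<forall>a. \<forall>x\<in>X. f (actX a x) = actY a (f x)) \<and> (\<forall>x. x \<notin> X \<longrightarrow> f x = 0)}"

abbreviation lhom ::
  "('a::ring_1 \<Rightarrow> 'b::ab_group_add \<Rightarrow> 'b) \<Rightarrow> ('a \<Rightarrow> 'c::ab_group_add \<Rightarrow> 'c) \<Rightarrow> ('b \<Rightarrow> 'c) set" where
  "lhom actX actY \<equiv> hom_on UNIV actX UNIV actY"

text \<open>
  Projectivity and injectivity by the usual lifting and extension properties. HOL cannot quantify
  over all types inside a formula, so the types carrying the two test modules are parameters.
  A module fails to be projective (injective) iff some choice of these types contains a failing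
  test diagram; hence a theorem with free test types that assumes the negation of one of these
  predicates covers every module that is not projective (injective) in the usual sense.
\<close>

definition projective_module ::
  "'x::ab_group_add itself \<Rightarrow> 'y::ab_group_add itself \<Rightarrow>
   ('a::ring_1 \<Rightarrow> 'm::ab_group_add \<Rightarrow> 'm) \<Rightarrow> bool" where
  "projective_module _ _ act \<longleftrightarrow>
     (\<forall>(actX :: 'a \<Rightarrow> 'x \<Rightarrow> 'x) (actY :: 'a \<Rightarrow> 'y \<Rightarrow> 'y) p f.
        left_module actX \<longrightarrow> left_module actY \<longrightarrow>
        p \<in> lhom actX actY \<longrightarrow> surj p \<longrightarrow> f \<in> lhom act actY \<longrightarrow>
        (\<exists>h \<in> lhom act actX. p \<circ> h = f))"

definition injective_module ::
  "'x::ab_group_add itself \<Rightarrow> 'y::ab_group_add itself \<Rightarrow>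
   ('a::ring_1 \<Rightarrow> 'm::ab_group_add \<Rightarrow> 'm) \<Rightarrow> bool" where
  "injective_module _ _ act \<longleftrightarrow>
     (\<forall>(actX :: 'a \<Rightarrow> 'x \<Rightarrow> 'x) (actY :: 'a \<Rightarrow> 'y \<Rightarrow> 'y) j f.
        left_module actX \<longrightarrow> left_module actY \<longrightarrow>
        j \<in> lhom actX actY \<longrightarrow> inj j \<longrightarrow> f \<in> lhom actX act \<longrightarrow>
        (\<exists>h \<in> lhom actY act. h \<circ> j = f))"

abbreviation regular_act :: "'a::ring_1 \<Rightarrow> 'a \<Rightarrow> 'a" where
  "regular_act \<equiv> (*)"

section \<open>Short local algebras\<close>

definition maximal_left_ideal :: "'a::ring_1 set \<Rightarrow> bool" where
  "maximal_left_ideal I \<longleftrightarrow>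
     submod regular_act I \<and> I \<noteq> UNIV \<and>
     (\<forall>K. submod regular_act K \<and> I \<subseteq> K \<longrightarrow> K = I \<or> K = UNIV)"

definition radical :: "'a::ring_1 set" where
  "radical = \<Inter> {I. maximal_left_ideal I}"

definition ideal_mult :: "'a::ring_1 set \<Rightarrow> 'a set \<Rightarrow> 'a set" where
  "ideal_mult I K = {\<Sum>(x, y)\<leftarrow>ps. x * y | ps. set ps \<subseteq> I \<times> K}"

locale fd_algebra = vector_space scale
  for scale :: "'k::field \<Rightarrow> 'a::ring_1 \<Rightarrow> 'a" +
  assumes scale_mult_left: "scale c (x * y) = scale c x * y"
    and scale_mult_right: "scale c (x * y) = x * scale c y"
    and finite_dim: "\<exists>B. finite B \<and> span B = UNIV"

text \<open>
  residue_field says that the canonical map from the ground field to the quotient of the algebra by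
  its radical is bijective.
\<close>

locale local_algebra = fd_algebra scale
  for scale :: "'k::field \<Rightarrow> 'a::ring_1 \<Rightarrow> 'a" +
  assumes local_ring: "\<exists>!I :: 'a set. maximal_left_ideal I"
    and residue_field: "\<forall>a. \<exists>!c. a - scale c 1 \<in> radical"

locale short_local_algebra = local_algebra scale
  for scale :: "'k::field \<Rightarrow> 'a::ring_1 \<Rightarrow> 'a" +
  assumes radical_cubed: "ideal_mult (ideal_mult radical radical) radical = {0 :: 'a}"

section \<open>Extension groups\<close>

text \<open>The free left module of rank n: functions nat to 'a supported on {..<n}.\<close>

definition free_carrier :: "nat \<Rightarrow> (nat \<Rightarrow> 'a::ring_1) set" where
  "free_carrier n = {v. \<forall>j\<ge>n. v j = 0}"

definition free_act :: "'a::ring_1 \<Rightarrow> (nat \<Rightarrow> 'a) \<Rightarrow> (nat \<Rightarrow> 'a)" where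
  "free_act a v = (\<lambda>j. a * v j)"

text \<open>
  An exact sequence ... --> F 2 --> F 1 --> F 0 --> M --> 0, where F i is free of rank r i,
  d i maps F (i + 1) to F i, and e maps F 0 to M.
\<close>

definition free_resolution ::
  "('a::ring_1 \<Rightarrow> 'm::ab_group_add \<Rightarrow> 'm) \<Rightarrow> (nat \<Rightarrow> nat) \<Rightarrow>
   (nat \<Rightarrow> (nat \<Rightarrow> 'a) \<Rightarrow> (nat \<Rightarrow> 'a)) \<Rightarrow> ((nat \<Rightarrow> 'a) \<Rightarrow> 'm) \<Rightarrow> bool" where
  "free_resolution act r d e \<longleftrightarrow>
     e \<in> hom_on (free_carrier (r 0)) free_act UNIV act \<and>
     (\<forall>i. d i \<in> hom_on (free_carrier (r (Suc i))) free_act (free_carrier (r i)) free_act) \<and>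
     e ` free_carrier (r 0) = UNIV \<and>
     {x \<in> free_carrier (r 0). e x = 0} = d 0 ` free_carrier (r (Suc 0)) \<and>
     (\<forall>i. {x \<in> free_carrier (r (Suc i)). d i x = 0} = d (Suc i) ` free_carrier (r (Suc (Suc i))))"

text \<open>The cochain complex of homomorphisms from a free resolution to a module N, and its cohomology.\<close>

definition cocycles ::
  "(nat \<Rightarrow> nat) \<Rightarrow> (nat \<Rightarrow> (nat \<Rightarrow> 'a) \<Rightarrow> (nat \<Rightarrow> 'a)) \<Rightarrow>
   ('a::ring_1 \<Rightarrow> 'n::ab_group_add \<Rightarrow> 'n) \<Rightarrow> nat \<Rightarrow> ((nat \<Rightarrow> 'a) \<Rightarrow> 'n) set" where
  "cocycles r d actN i =
     {f \<in> hom_on (free_carrier (r i)) free_act UNIV actN. f \<circ> d i = 0}"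

definition coboundaries ::
  "(nat \<Rightarrow> nat) \<Rightarrow> (nat \<Rightarrow> (nat \<Rightarrow> 'a) \<Rightarrow> (nat \<Rightarrow> 'a)) \<Rightarrow>
   ('a::ring_1 \<Rightarrow> 'n::ab_group_add \<Rightarrow> 'n) \<Rightarrow> nat \<Rightarrow> ((nat \<Rightarrow> 'a) \<Rightarrow> 'n) set" where
  "coboundaries r d actN i =
     (case i of 0 \<Rightarrow> {0}
      | Suc j \<Rightarrow> (\<lambda>g. g \<circ> d j) ` hom_on (free_carrier (r j)) free_act UNIV actN)"

definition cohomology_group ::
  "(nat \<Rightarrow> nat) \<Rightarrow> (nat \<Rightarrow> (nat \<Rightarrow> 'a) \<Rightarrow> (nat \<Rightarrow> 'a)) \<Rightarrow>
   ('a::ring_1 \<Rightarrow> 'n::ab_group_add \<Rightarrow> 'n) \<Rightarrow> nat \<Rightarrow> ((nat \<Rightarrow> 'a) \<Rightarrow> 'n) set monoid" where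
  "cohomology_group r d actN i =
     \<lparr>carrier = cocycles r d actN i, monoid.mult = (+), one = 0\<rparr> Mod coboundaries r d actN i"

text \<open>
  Ext is computed with a chosen resolution of the first argument by free modules of finite rank.
  By the comparison theorem, other choices give isomorphic groups. Such a resolution exists for
  every module of finite length over a finite-dimensional algebra (proved below).
\<close>

definition chosen_resolution ::
  "('a::ring_1 \<Rightarrow> 'm::ab_group_add \<Rightarrow> 'm) \<Rightarrow>
   (nat \<Rightarrow> nat) \<times> (nat \<Rightarrow> (nat \<Rightarrow> 'a) \<Rightarrow> (nat \<Rightarrow> 'a))" where
  "chosen_resolution act = (SOME (r, d). \<exists>e. free_resolution act r d e)"

definition Ext_group ::
  "nat \<Rightarrow> ('a::ring_1 \<Rightarrow> 'm::ab_group_add \<Rightarrow> 'm) \<Rightarrow> ('a \<Rightarrow> 'n::ab_group_add \<Rightarrow> 'n) \<Rightarrow>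
   ((nat \<Rightarrow> 'a) \<Rightarrow> 'n) set monoid" where
  "Ext_group i actM actN = (case chosen_resolution actM of (r, d) \<Rightarrow> cohomology_group r d actN i)"

definition semi_Gorenstein_projective :: "('a::ring_1 \<Rightarrow> 'm::ab_group_add \<Rightarrow> 'm) \<Rightarrow> bool" where
  "semi_Gorenstein_projective act \<longleftrightarrow> (\<forall>i\<ge>1. trivial_group (Ext_group i act regular_act))"

section \<open>Well-definedness of the extension groups\<close>

lemma submod_closed:
  assumes "submod act S"
  shows "0 \<in> S" "\<And>x y. x \<in> S \<Longrightarrow> y \<in> S \<Longrightarrow> x + y \<in> S" "\<And>a x. x \<in> S \<Longrightarrow> act a x \<in> S"
  using assms by (auto simp: submod_def)

lemma submod_sum:
  assumes "submod act S" "\<And>i. i \<in> I \<Longrightarrow> f i \<in> S"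
  shows "sum f I \<in> S"
  using assms(2) by (induction I rule: infinite_finite_induct) (auto simp: submod_closed[OF assms(1)])

context left_module
begin

lemma act_zero_right: "act a 0 = 0"
  using act_add_right[of a 0 0] by simp

lemma act_zero_left: "act 0 x = 0"
  using act_add_left[of 0 0 x] by simp

lemma act_minus: "act a (- x) = - act a x"
  using act_add_right[of a x "- x"] by (simp add: act_zero_right minus_unique)

lemma act_sum: "act a (sum f I) = (\<Sum>i\<in>I. act a (f i))"
  by (induction I rule: infinite_finite_induct) (auto simp: act_zero_right act_add_right)

lemma submod_UNIV: "submod act UNIV"
  by (auto simp: submod_def)

end

lemma left_module_free_act: "left_module (free_act :: 'a::ring_1 \<Rightarrow> _)"
  by standard (auto simp: free_act_def fun_eq_iff algebra_simps)

lemma submod_free_carrier: "submod free_act (free_carrier n)"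
  by (auto simp: submod_def free_carrier_def free_act_def)

lemma submod_kernel:
  assumes f: "f \<in> hom_on X actX Y actY" and X: "submod actX X" and "left_module actY"
  shows "submod actX {x \<in> X. f x = 0}"
proof -
  interpret left_module actY by fact
  have "f (0 + 0) = f 0 + f 0" using f submod_closed(1)[OF X] unfolding hom_on_def by blast
  hence "f 0 = 0" by simp
  with f show ?thesis using submod_closed[OF X] act_zero_right
    by (auto simp: submod_def hom_on_def)
qed

lemma hom_on_free_cover:
  assumes "left_module act" and S: "submod act S" and v: "\<And>j. j < m \<Longrightarrow> v j \<in> S"
  shows "(\<lambda>c. if c \<in> free_carrier m then (\<Sum>j<m. act (c j) (v j)) else 0)
           \<in> hom_on (free_carrier m) free_act S act"
proof -
  interpret left_module act by fact
  have "(\<Sum>j<m. act (c j) (v j)) \<in> S" for c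
    by (intro submod_sum[OF S] submod_closed[OF S] v) auto
  then show ?thesis
    using submod_closed[OF submod_free_carrier[of m, where ?'a = 'a]]
    by (auto simp: hom_on_def act_add_left sum.distrib act_sum act_act free_act_def[abs_def])
qed

context fd_algebra
begin

lemma scale_one_mult: "scale c 1 * x = scale c x"
  using scale_mult_left[of c 1 x] by simp

definition induced_scale :: "('a \<Rightarrow> 'm::ab_group_add \<Rightarrow> 'm) \<Rightarrow> 'k \<Rightarrow> 'm \<Rightarrow> 'm" where
  "induced_scale act c x = act (scale c 1) x"

lemma vector_space_induced:
  assumes "left_module act"
  shows "vector_space (induced_scale act)"
proof -
  interpret left_module act by fact
  show ?thesis
    by unfold_locales
      (simp_all add: induced_scale_def act_add_right scale_left_distrib act_add_left act_act act_one
        scale_one_mult)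
qed

lemma act_orbit_span:
  assumes "left_module act"
  shows "\<exists>T. finite T \<and> range (\<lambda>a. act a x) \<subseteq> module.span (induced_scale act) T"
proof -
  interpret M: left_module act by fact
  interpret V: vector_space "induced_scale act" by (rule vector_space_induced) fact
  obtain B where B: "finite B" "span B = UNIV" using finite_dim by blast
  have "act a x \<in> V.span ((\<lambda>b. act b x) ` B)" for a
  proof -
    have "a \<in> span B" using B by simp
    then show ?thesis
    proof (induction rule: span_induct_alt)
      case base
      then show ?case by (simp add: M.act_zero_left V.span_zero)
    next
      case (step c b y)
      have "act (scale c b + y) x = induced_scale act c (act b x) + act y x"
        by (simp add: M.act_add_left induced_scale_def M.act_act scale_one_mult)
      then show ?case using step
        by (auto intro!: V.span_add V.span_scale intro: V.span_base)
    qed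
  qed
  then show ?thesis using B(1) by blast
qed

lemma finite_length_span:
  assumes "left_module act" "finite_length act"
  shows "\<exists>T. finite T \<and> module.span (induced_scale act) T = UNIV"
proof -
  interpret M: left_module act by fact
  interpret V: vector_space "induced_scale act" by (rule vector_space_induced) fact
  from assms(2)[unfolded finite_length_def] obtain n C where "C 0 = {0} \<and> C n = UNIV \<and> (\<forall>i\<le>n. submod act (C i)) \<and>
      (\<forall>i<n. C i \<subset> C (Suc i) \<and> \<not> (\<exists>S. submod act S \<and> C i \<subset> S \<and> S \<subset> C (Suc i)))"
    by (elim exE)
  then have C: "C 0 = {0}" "C n = UNIV" "\<And>i. i \<le> n \<Longrightarrow> submod act (C i)"
    "\<And>i. i < n \<Longrightarrow> C i \<subset> C (Suc i)"
    "\<And>i S. i < n \<Longrightarrow> submod act S \<Longrightarrow> C i \<subset> S \<Longrightarrow> \<not> S \<subset> C (Suc i)"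
    by simp_all
  have "i \<le> n \<Longrightarrow> \<exists>T. finite T \<and> C i \<subseteq> V.span T" for i
  proof (induction i)
    case 0
    then show ?case using C(1) V.span_zero by (intro exI[of _ "{}"]) auto
  next
    case (Suc i)
    then obtain T where T: "finite T" "C i \<subseteq> V.span T" by auto
    from Suc.prems have i: "i < n" "submod act (C i)" "submod act (C (Suc i))" using C(3) by auto
    obtain x where x: "x \<in> C (Suc i)" "x \<notin> C i" using C(4)[OF i(1)] by blast
    define S where "S = {y + act a x | y a. y \<in> C i}"
    have SI: "y + act a x \<in> S" if "y \<in> C i" for y a
      using that by (auto simp: S_def)
    have SE: "\<exists>y a. u = y + act a x \<and> y \<in> C i" if "u \<in> S" for u
      using that by (auto simp: S_def)
    have "submod act S"
      unfolding submod_def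
    proof (intro conjI ballI allI)
      show "0 \<in> S" using SI[OF submod_closed(1)[OF i(2)], of 0] by (simp add: M.act_zero_left)
    next
      fix u v assume "u \<in> S" "v \<in> S"
      then obtain y a z b where uv: "u = y + act a x" "v = z + act b x" "y \<in> C i" "z \<in> C i"
        using SE by metis
      have "u + v = (y + z) + act (a + b) x" by (simp add: uv M.act_add_left)
      then show "u + v \<in> S" using SI[OF submod_closed(2)[OF i(2) uv(3,4)]] by simp
    next
      fix b u assume "u \<in> S"
      then obtain y a where u: "u = y + act a x" "y \<in> C i" using SE by metis
      have "act b u = act b y + act (b * a) x" by (simp add: u M.act_add_right M.act_act)
      then show "act b u \<in> S" using SI[OF submod_closed(3)[OF i(2) u(2)]] by simp
    qed
    moreover have "C i \<subset> S"
    proof -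
      have "y \<in> S" if "y \<in> C i" for y
        using SI[OF that, of 0] by (simp add: M.act_zero_left)
      moreover have "x \<in> S"
        using SI[OF submod_closed(1)[OF i(2)], of 1] by (simp add: M.act_one)
      ultimately show ?thesis using x by blast
    qed
    moreover have "S \<subseteq> C (Suc i)"
      using submod_closed[OF i(3)] x C(4)[OF i(1)] by (auto simp: S_def)
    ultimately have S: "S = C (Suc i)" using C(5)[OF i(1)] by blast
    obtain T' where T': "finite T'" "range (\<lambda>a. act a x) \<subseteq> V.span T'"
      using act_orbit_span[OF assms(1)] by blast
    have "C (Suc i) \<subseteq> V.span (T \<union> T')"
    proof
      fix u assume "u \<in> C (Suc i)"
      then obtain y a where "u = y + act a x" "y \<in> C i" using S SE by blast
      moreover have "act a x \<in> V.span T'" using T' by blast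
      ultimately show "u \<in> V.span (T \<union> T')"
        using T V.span_mono[of T "T \<union> T'"] V.span_mono[of T' "T \<union> T'"]
        by (auto intro!: V.span_add)
    qed
    then show ?case using T T' by blast
  qed
  from this[of n] show ?thesis using C(2) by auto
qed

lemma free_carrier_span:
  "\<exists>T. finite T \<and> free_carrier n \<subseteq> module.span (induced_scale free_act) T"
proof -
  interpret M: left_module "free_act :: 'a \<Rightarrow> _" by (rule left_module_free_act)
  interpret V: vector_space "induced_scale free_act"
    by (rule vector_space_induced) (rule left_module_free_act)
  show ?thesis
  proof (induction n)
    case 0
    have "free_carrier 0 = {0 :: nat \<Rightarrow> 'a}" by (auto simp: free_carrier_def fun_eq_iff)
    then show ?case using V.span_zero by (intro exI[of _ "{}"]) auto
  next
    case (Suc n)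
    then obtain T where T: "finite T" "free_carrier n \<subseteq> V.span T" by blast
    define x :: "nat \<Rightarrow> 'a" where "x = (\<lambda>j. if j = n then 1 else 0)"
    obtain T' where T': "finite T'" "range (\<lambda>a. free_act a x) \<subseteq> V.span T'"
      using act_orbit_span[OF left_module_free_act] by blast
    have "free_carrier (Suc n) \<subseteq> V.span (T \<union> T')"
    proof
      fix v :: "nat \<Rightarrow> 'a" assume "v \<in> free_carrier (Suc n)"
      then have "v(n := 0) \<in> free_carrier n" by (auto simp: free_carrier_def)
      moreover have "v(n := 0) + free_act (v n) x = v"
        by (auto simp: free_act_def x_def fun_eq_iff)
      moreover have "free_act (v n) x \<in> V.span T'" using T' by blast
      ultimately show "v \<in> V.span (T \<union> T')"
        using T V.span_mono[of T "T \<union> T'"] V.span_mono[of T' "T \<union> T'"]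
          V.span_add[of "v(n := 0)" "T \<union> T'" "free_act (v n) x"] by auto
    qed
    then show ?case using T T' by blast
  qed
qed

lemma free_cover_exists:
  assumes "left_module act" and S: "submod act S"
    and T: "finite T" "S \<subseteq> module.span (induced_scale act) T"
  shows "\<exists>m f. f \<in> hom_on (free_carrier m) free_act S act \<and> f ` free_carrier m = S"
proof -
  interpret M: left_module act by fact
  interpret V: vector_space "induced_scale act" by (rule vector_space_induced) fact
  obtain B where B: "B \<subseteq> S" "V.independent B" "S \<subseteq> V.span B"
    using V.maximal_independent_subset by blast
  have "finite B" using V.independent_span_bound[OF T(1) B(2)] B(1) T(2) by blast
  then obtain m and v :: "nat \<Rightarrow> 'b" where v: "bij_betw v {..<m} B"
    using ex_bij_betw_nat_finite[of B] atLeast0LessThan by auto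
  define f where "f = (\<lambda>c. if c \<in> free_carrier m then (\<Sum>j<m. act (c j) (v j)) else 0)"
  have f: "f \<in> hom_on (free_carrier m) free_act S act"
    unfolding f_def using v B(1)
    by (intro hom_on_free_cover assms(1) S) (auto simp: bij_betw_def)
  have "S \<subseteq> f ` free_carrier m"
  proof
    fix x assume "x \<in> S"
    then obtain u where "x = (\<Sum>b\<in>B. induced_scale act (u b) b)"
      using B(3) V.span_finite[OF \<open>finite B\<close>] by blast
    also have "\<dots> = (\<Sum>j<m. act (scale (u (v j)) 1) (v j))"
      using sum.reindex_bij_betw[OF v, of "\<lambda>b. induced_scale act (u b) b"]
      by (simp add: induced_scale_def)
    also have "\<dots> = f (\<lambda>j. if j < m then scale (u (v j)) 1 else 0)"
      by (auto simp: f_def free_carrier_def)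
    finally show "x \<in> f ` free_carrier m" by (auto simp: free_carrier_def)
  qed
  with f show ?thesis unfolding hom_on_def by blast
qed

lemma free_kernel_cover_exists:
  fixes actY :: "'a \<Rightarrow> 'n::ab_group_add \<Rightarrow> 'n"
  assumes "f \<in> hom_on (free_carrier n) free_act Y actY" "left_module actY"
  shows "\<exists>m g. g \<in> hom_on (free_carrier m) free_act (free_carrier n) free_act \<and>
    g ` free_carrier m = {x \<in> free_carrier n. f x = 0}"
proof -
  let ?K = "{x \<in> free_carrier n. f x = 0}"
  obtain T where T: "finite T" "free_carrier n \<subseteq> module.span (induced_scale free_act) T"
    using free_carrier_span by blast
  have "submod free_act ?K" by (rule submod_kernel[OF assms(1) submod_free_carrier assms(2)])
  then obtain m g where g: "g \<in> hom_on (free_carrier m) free_act ?K free_act" "g ` free_carrier m = ?K"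
    using free_cover_exists[OF left_module_free_act, of ?K T] T by blast
  from g(1) have "g \<in> hom_on (free_carrier m) free_act (free_carrier n) free_act"
    by (auto simp: hom_on_def)
  with g(2) show ?thesis by blast
qed

theorem free_resolution_exists:
  fixes act :: "'a \<Rightarrow> 'm::ab_group_add \<Rightarrow> 'm"
  assumes "left_module act" "finite_length act"
  shows "\<exists>r d e. free_resolution act r d e"
proof -
  interpret M: left_module act by fact
  obtain r0 e where e: "e \<in> hom_on (free_carrier r0) free_act UNIV act" "e ` free_carrier r0 = UNIV"
    using finite_length_span[OF assms] free_cover_exists[OF assms(1) M.submod_UNIV] by blast
  obtain r1 d0 where d0: "d0 \<in> hom_on (free_carrier r1) free_act (free_carrier r0) free_act"
    "d0 ` free_carrier r1 = {x \<in> free_carrier r0. e x = 0}"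
    using free_kernel_cover_exists[OF e(1) assms(1)] by blast
  define P :: "nat \<Rightarrow> nat \<times> nat \<times> ((nat \<Rightarrow> 'a) \<Rightarrow> (nat \<Rightarrow> 'a)) \<Rightarrow> bool" where
    "P = (\<lambda>i (p, q, f). f \<in> hom_on (free_carrier q) free_act (free_carrier p) free_act \<and>
            (i = 0 \<longrightarrow> (p, q, f) = (r0, r1, d0)))"
  define Q :: "nat \<Rightarrow> nat \<times> nat \<times> ((nat \<Rightarrow> 'a) \<Rightarrow> (nat \<Rightarrow> 'a)) \<Rightarrow>
      nat \<times> nat \<times> ((nat \<Rightarrow> 'a) \<Rightarrow> (nat \<Rightarrow> 'a)) \<Rightarrow> bool" where
    "Q = (\<lambda>i (p, q, f) (p', q', f'). p' = q \<and>
            f' ` free_carrier q' = {x \<in> free_carrier q. f x = 0})"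
  have "\<exists>s. \<forall>i. P i (s i) \<and> Q i (s i) (s (Suc i))"
  proof (rule dependent_nat_choice)
    show "\<exists>x. P 0 x" using d0 by (auto simp: P_def)
  next
    fix x i assume "P i x"
    obtain p q f where x: "x = (p, q, f)" by (cases x)
    with \<open>P i x\<close> have "f \<in> hom_on (free_carrier q) free_act (free_carrier p) free_act"
      by (simp add: P_def)
    from free_kernel_cover_exists[OF this left_module_free_act] obtain m g where
      "g \<in> hom_on (free_carrier m) free_act (free_carrier q) free_act"
      "g ` free_carrier m = {x \<in> free_carrier q. f x = 0}" by blast
    then have "P (Suc i) (q, m, g) \<and> Q i x (q, m, g)" by (simp add: P_def Q_def x)
    then show "\<exists>y. P (Suc i) y \<and> Q i x y" by blast
  qed
  then obtain s where s: "\<And>i. P i (s i)" "\<And>i. Q i (s i) (s (Suc i))" by blast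
  define r where "r i = fst (s i)" for i
  define d where "d i = snd (snd (s i))" for i
  have s_eq: "s i = (r i, r (Suc i), d i)" for i
    using s(2)[of i] by (auto simp: Q_def r_def d_def split: prod.splits)
  have 0: "r 0 = r0" "r (Suc 0) = r1" "d 0 = d0" using s(1)[of 0] s_eq[of 0] by (auto simp: P_def)
  have "free_resolution act r d e"
    unfolding free_resolution_def
  proof (intro conjI allI)
    fix i
    show "d i \<in> hom_on (free_carrier (r (Suc i))) free_act (free_carrier (r i)) free_act"
      using s(1)[of i] by (simp add: s_eq P_def)
    show "{x \<in> free_carrier (r (Suc i)). d i x = 0} = d (Suc i) ` free_carrier (r (Suc (Suc i)))"
      using s(2)[of i] by (simp add: s_eq Q_def)
  qed (use e d0 0 in auto)
  then show ?thesis by blast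
qed

lemma chosen_resolution_free_resolution:
  fixes act :: "'a \<Rightarrow> 'm::ab_group_add \<Rightarrow> 'm"
  assumes "left_module act" "finite_length act" "chosen_resolution act = (r, d)"
  shows "\<exists>e. free_resolution act r d e"
proof -
  have "case chosen_resolution act of (r, d) \<Rightarrow> \<exists>e. free_resolution act r d e"
    unfolding chosen_resolution_def
    using free_resolution_exists[OF assms(1,2)]
    by (intro someI_ex[of "\<lambda>(r, d). \<exists>e. free_resolution act r d e"]) auto
  then show ?thesis using assms(3) by simp
qed

end

lemma comm_group_cochains:
  assumes "0 \<in> Z" "\<And>f g. f \<in> Z \<Longrightarrow> g \<in> Z \<Longrightarrow> f + g \<in> Z" "\<And>f. f \<in> Z \<Longrightarrow> - f \<in> (Z :: 'g::ab_group_add set)"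
  shows "comm_group \<lparr>carrier = Z, monoid.mult = (+), one = 0\<rparr>"
proof (rule comm_groupI, simp_all only: monoid.simps partial_object.simps)
  show "\<exists>y\<in>Z. y + x = 0" if "x \<in> Z" for x
    by (rule bexI[of _ "- x"]) (simp_all add: assms(3) that)
qed (simp_all only: assms(1,2) ac_simps add_0 add_0_right)

lemma hom_on_subgroup:
  assumes "left_module actY"
  shows "0 \<in> hom_on X actX UNIV actY"
    and "f \<in> hom_on X actX UNIV actY \<Longrightarrow> g \<in> hom_on X actX UNIV actY \<Longrightarrow> f + g \<in> hom_on X actX UNIV actY"
    and "f \<in> hom_on X actX UNIV actY \<Longrightarrow> - f \<in> hom_on X actX UNIV actY"
proof -
  interpret left_module actY by fact
  show "0 \<in> hom_on X actX UNIV actY"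
    "f \<in> hom_on X actX UNIV actY \<Longrightarrow> g \<in> hom_on X actX UNIV actY \<Longrightarrow> f + g \<in> hom_on X actX UNIV actY"
    "f \<in> hom_on X actX UNIV actY \<Longrightarrow> - f \<in> hom_on X actX UNIV actY"
    by (auto simp: hom_on_def act_zero_right act_add_right act_minus algebra_simps)
qed

theorem
  fixes act :: "'a::ring_1 \<Rightarrow> 'm::ab_group_add \<Rightarrow> 'm"
    and actN :: "'a \<Rightarrow> 'n::ab_group_add \<Rightarrow> 'n"
  assumes res: "free_resolution act r d e" and N: "left_module actN"
  shows comm_group_cohomology: "comm_group (cohomology_group r d actN i)"
    and trivial_cohomology_iff:
      "trivial_group (cohomology_group r d actN i) \<longleftrightarrow> cocycles r d actN i \<subseteq> coboundaries r d actN i"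
proof -
  let ?Z = "cocycles r d actN i" and ?B = "coboundaries r d actN i"
  let ?G = "\<lparr>carrier = ?Z, monoid.mult = (+), one = 0\<rparr>"
  note H = hom_on_subgroup[OF N]
  have comp: "(f + g) \<circ> h = (f \<circ> h) + (g \<circ> h)" "(- f) \<circ> h = - (f \<circ> h)" "0 \<circ> h = 0"
    for f g :: "(nat \<Rightarrow> 'a) \<Rightarrow> 'n" and h :: "(nat \<Rightarrow> 'a) \<Rightarrow> nat \<Rightarrow> 'a" by (auto simp: fun_eq_iff)
  interpret Z: comm_group ?G
    by (rule comm_group_cochains) (auto simp: cocycles_def H comp)
  have d: "d j \<in> hom_on (free_carrier (r (Suc j))) free_act (free_carrier (r j)) free_act" for j
    using res by (simp add: free_resolution_def)
  have BZ: "?B \<subseteq> ?Z"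
  proof (cases i)
    case 0
    then show ?thesis by (auto simp: coboundaries_def cocycles_def H comp)
  next
    case (Suc j)
    have "g \<circ> d j \<in> ?Z" if g: "g \<in> hom_on (free_carrier (r j)) free_act UNIV actN" for g
    proof -
      have "g (0 + 0) = g 0 + g 0"
        using g submod_closed(1)[OF submod_free_carrier] unfolding hom_on_def by blast
      then have g0: "g 0 = 0" by simp
      have "g \<circ> d j \<in> hom_on (free_carrier (r (Suc j))) free_act UNIV actN"
        using d[of j] g g0 by (auto simp: hom_on_def)
      moreover have dd: "d j (d (Suc j) x) = 0" for x
      proof (cases "x \<in> free_carrier (r (Suc (Suc j)))")
        case True
        then show ?thesis using res unfolding free_resolution_def by blast
      next
        case False
        then have "d (Suc j) x = 0" using d[of "Suc j"] by (auto simp: hom_on_def)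
        moreover have "d j (0 + 0) = d j 0 + d j 0"
          using d[of j] submod_closed(1)[OF submod_free_carrier] unfolding hom_on_def by blast
        ultimately show ?thesis by simp
      qed
      moreover have "(g \<circ> d j) \<circ> d (Suc j) = 0" by (rule ext) (simp only: o_apply dd g0 zero_fun_apply)
      ultimately show ?thesis by (simp add: cocycles_def Suc)
    qed
    then show ?thesis by (auto simp: coboundaries_def Suc)
  qed
  have B: "0 \<in> ?B" "\<And>f g. f \<in> ?B \<Longrightarrow> g \<in> ?B \<Longrightarrow> f + g \<in> ?B" "\<And>f. f \<in> ?B \<Longrightarrow> - f \<in> ?B"
  proof -
    show "0 \<in> ?B"
      by (auto simp: coboundaries_def H comp image_iff split: nat.splits intro!: bexI[of _ 0])
    show "f + g \<in> ?B" if "f \<in> ?B" "g \<in> ?B" for f g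
      using that by (auto simp: coboundaries_def split: nat.splits simp flip: comp intro!: imageI H)
    show "- f \<in> ?B" if "f \<in> ?B" for f
      using that by (auto simp: coboundaries_def split: nat.splits simp flip: comp intro!: imageI H)
  qed
  have inv: "inv\<^bsub>?G\<^esub> f = - f" if "f \<in> ?Z" for f
    using that by (intro Z.inv_equality) (auto simp: cocycles_def H comp)
  have sub: "subgroup ?B ?G"
    by (rule Z.subgroupI) (use B BZ inv in auto)
  show cg: "comm_group (cohomology_group r d actN i)"
    unfolding cohomology_group_def by (rule Z.abelian_FactGroup[OF sub])
  show "trivial_group (cohomology_group r d actN i) \<longleftrightarrow> ?Z \<subseteq> ?B"
  proof
    assume "trivial_group (cohomology_group r d actN i)"
    then have *: "(\<lambda>f. ?B #>\<^bsub>?G\<^esub> f) ` ?Z = {?B}"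
      by (auto simp: trivial_group_def cohomology_group_def carrier_FactGroup)
    show "?Z \<subseteq> ?B"
    proof
      fix f assume f: "f \<in> ?Z"
      have "f \<in> ?B #>\<^bsub>?G\<^esub> f" using B(1) by (auto simp: r_coset_def intro!: bexI[of _ 0])
      then show "f \<in> ?B" using f * by blast
    qed
  next
    assume "?Z \<subseteq> ?B"
    then have "?B = carrier ?G" using BZ by auto
    then have "?B #>\<^bsub>?G\<^esub> f = ?B" if "f \<in> ?Z" for f
      using Z.coset_join2[OF _ sub, of f] that by auto
    then have "carrier (cohomology_group r d actN i) = {\<one>\<^bsub>cohomology_group r d actN i\<^esub>}"
      using B(1) BZ by (auto simp: cohomology_group_def carrier_FactGroup image_iff)
    then show "trivial_group (cohomology_group r d actN i)"
      using cg by (simp add: trivial_group_def comm_group_def)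
  qed
qed

end

theory Submission
  imports Defs
begin

text \<open>
  Let J be the radical of A, a = dim J^2 and e = dim J/J^2. In a minimal free resolution of M let
  t j be the rank of the free module F j, and let K j, a submodule of J F j, be the image of F (j + 1);
  so K j is the syzygy of M with index j + 1, and its top has dimension t (j + 1). No K j vanishes:
  M is not projective, and a nonzero free syzygy has a projection onto A that cannot extend
  to the free module whose radical contains the syzygy, although Ext(M, A) = 0.

  Suppose that the i-th extension group of M by itself vanishes. Since Ext(M, A) = 0, the same then holds
  for each K j, by a dimension shift in both arguments: all homomorphisms from K (i + j) to K j extend
  to F (i + j). Extended homomorphisms have values in J K j because K (i + j) lies in J F (i + j), whereas
  each socle element of K j is a value of some homomorphism; hence the socle of K j lies in J K j. For
  j > 0 the socle contains J^2 F j, because J^3 = 0, and so J K j is equal to J^2 F j. This gives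
  dim K j = a t j + t (j + 1) and the recurrence t (j + 2) + a t j = e t (j + 1).

  What remains is to count dimensions in the complex of homomorphisms from the resolution to N = K j,
  whose term with index l is the power of N with exponent t l. All its differentials have
  coefficients in J, so they vanish on tuples with entries in J^2 F j and have such tuples as values.
  Exactness at index i + j + 1 yields a t j t (i + j + 1) \<le> t (i + j) t (j + 1).

  For i = 1 the inequality is strict, because the free cover of K j is a further cocycle. Bounding the
  kernel from below also by the rank of the next differential gives a second inequality, and the two
  contradict each other by the recurrence.

  For general i and a \<ge> 2 the inequality forces the quotients t (j + 1) / t j to tend to 0, which is
  impossible for positive integers. If a = 0, then K 1 is semisimple, but its socle lies in J K 1 = 0.
  If a = 1, another count, now of homomorphisms to A, shows that the left socle of A is J^2. Thus the socle is
  simple, A is a Frobenius algebra, and A is self-injective.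

  Homomorphisms from free modules are represented by tuples of values at the unit vectors, so that the
  spaces of such homomorphisms are powers N^n. The resolution that defines Ext need not be minimal;
  it is compared with a minimal one by maps that are inverse to each other up to maps that extend to free modules.
\<close>

section \<open>Dimensions of finite-dimensional subspaces\<close>

text \<open>
  The syzygies are finite-dimensional subspaces of the space of all functions from nat to A, which is
  infinite-dimensional, so dimensions are needed relative to such subspaces. A locale different
  from vector_space keeps these notions apart from those for real vector spaces, which interpret
  vector_space globally.
\<close>

locale subspace_dimension = vector_space scale
  for scale :: "'k::field \<Rightarrow> 'b::ab_group_add \<Rightarrow> 'b"
begin

definition findim :: "'b set \<Rightarrow> bool" where
  "findim S \<longleftrightarrow> subspace S \<and> (\<exists>T. finite T \<and> S \<subseteq> span T)"

lemma findim_subspace: "findim S \<Longrightarrow> subspace S"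
  by (simp add: findim_def)

lemma findim_independent_finite:
  assumes "findim S" "B \<subseteq> S" "independent B"
  shows "finite B"
  using assms independent_span_bound unfolding findim_def by (meson order_trans)

lemma findim_mono: "findim T \<Longrightarrow> subspace S \<Longrightarrow> S \<subseteq> T \<Longrightarrow> findim S"
  unfolding findim_def by (meson order_trans)

lemma findim_extend_basis:
  assumes "findim T" "B \<subseteq> T" "independent B"
  obtains C where "B \<subseteq> C" "C \<subseteq> T" "independent C" "span C = T" "finite C" "card C = dim T"
proof -
  obtain C where C: "B \<subseteq> C" "C \<subseteq> T" "independent C" "T \<subseteq> span C"
    using maximal_independent_subset_extend[OF assms(2,3)] by blast
  moreover have "span C \<subseteq> T" using C(2) findim_subspace[OF assms(1)] by (rule span_minimal)
  ultimately show ?thesis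
    using findim_independent_finite[OF assms(1) C(2,3)] basis_card_eq_dim[of C T] that by auto
qed

lemma findim_basis:
  assumes "findim S"
  obtains B where "B \<subseteq> S" "independent B" "span B = S" "finite B" "card B = dim S"
  by (rule findim_extend_basis[OF assms, of "{}"]) (use independent_empty in auto)

lemma dim_mono_findim:
  assumes "findim T" "subspace S" "S \<subseteq> T"
  shows "dim S \<le> dim T"
proof -
  obtain B where B: "B \<subseteq> S" "independent B" "card B = dim S"
    by (rule findim_basis[OF findim_mono[OF assms]])
  obtain C where "B \<subseteq> C" "finite C" "card C = dim T"
    by (rule findim_extend_basis[OF assms(1) order_trans[OF B(1) assms(3)] B(2)])
  then show ?thesis using B(3) card_mono by metis
qed

lemma dim_eq_findim:
  assumes "findim T" "subspace S" "S \<subseteq> T" "dim T \<le> dim S"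
  shows "S = T"
proof -
  obtain B where B: "B \<subseteq> S" "independent B" "card B = dim S" "span B = S"
    by (rule findim_basis[OF findim_mono[OF assms(1-3)]])
  obtain C where C: "B \<subseteq> C" "finite C" "card C = dim T" "span C = T"
    by (rule findim_extend_basis[OF assms(1) order_trans[OF B(1) assms(3)] B(2)])
  then have "B = C" using card_seteq[of C B] assms(4) B(3) by simp
  then show ?thesis using B C by simp
qed

lemma dim_zero: "dim {0} = 0"
  using dim_unique[of "{}" "{0}" 0] independent_empty by simp

lemma findim_zero: "findim {0}"
  using subspace_single_0 by (auto simp: findim_def intro!: exI[of _ "{}"])

lemma dim_pos:
  assumes "findim S" "x \<in> S" "x \<noteq> 0"
  shows "0 < dim S"
  using dim_eq_findim[OF assms(1) subspace_single_0] findim_subspace[OF assms(1)] subspace_0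
    assms(2,3) dim_zero by fastforce

end

locale subspace_dimension_pair =
  vs1: subspace_dimension s1 + vs2: subspace_dimension s2
  for s1 :: "'k::field \<Rightarrow> 'b::ab_group_add \<Rightarrow> 'b"
    and s2 :: "'k \<Rightarrow> 'c::ab_group_add \<Rightarrow> 'c"
begin

sublocale vector_space_pair s1 s2 ..

lemma findim_image:
  assumes f: "Vector_Spaces.linear s1 s2 f" and S: "vs1.findim S"
  shows "vs2.findim (f ` S)"
proof -
  obtain T where T: "finite T" "S \<subseteq> vs1.span T" using S unfolding vs1.findim_def by blast
  have "f ` S \<subseteq> vs2.span (f ` T)" using T(2) linear_span_image[OF f, of T] by blast
  then show ?thesis using T(1) linear_subspace_image[OF f vs1.findim_subspace[OF S]]
    unfolding vs2.findim_def by blast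
qed

lemma findim_kernel:
  assumes f: "Vector_Spaces.linear s1 s2 f" and S: "vs1.findim S"
  shows "vs1.findim {x \<in> S. f x = 0}"
proof (rule vs1.findim_mono[OF S])
  show "vs1.subspace {x \<in> S. f x = 0}"
    using vs1.subspace_inter[OF vs1.findim_subspace[OF S] linear_subspace_kernel[OF f]]
    by (simp add: Int_def)
qed auto

text \<open>
  Rank-nullity relative to a finite-dimensional subspace: a basis of the kernel is extended to a
  basis of the subspace, and the new basis vectors are mapped to a basis of the image.
\<close>

lemma rank_nullity:
  assumes f: "Vector_Spaces.linear s1 s2 f" and S: "vs1.findim S"
  shows "vs1.dim S = vs2.dim (f ` S) + vs1.dim {x \<in> S. f x = 0}"
proof -
  let ?K = "{x \<in> S. f x = 0}"
  have K: "vs1.findim ?K" by (rule findim_kernel[OF f S])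
  obtain B where B: "B \<subseteq> ?K" "vs1.independent B" "vs1.span B = ?K" "card B = vs1.dim ?K"
    by (rule vs1.findim_basis[OF K])
  obtain C where C: "B \<subseteq> C" "C \<subseteq> S" "vs1.independent C" "vs1.span C = S" "finite C"
      "card C = vs1.dim S"
    by (rule vs1.findim_extend_basis[OF S _ B(2)]) (use B(1) in blast)
  let ?D = "C - B"
  have "vs1.span ?D \<inter> ?K = {0}"
  proof -
    have "vs1.span ?D \<inter> vs1.span B = {0}"
    proof -
      have "x = 0" if x: "x \<in> vs1.span ?D" "x \<in> vs1.span B" for x
      proof -
        from x(1) obtain u where u: "x = (\<Sum>b\<in>?D. s1 (u b) b)"
          using vs1.span_finite[of ?D] C(5) by auto
        from x(2) obtain w where w: "x = (\<Sum>b\<in>B. s1 (w b) b)"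
          using vs1.span_finite[of B] finite_subset[OF C(1,5)] by auto
        define c where "c b = (if b \<in> B then - w b else u b)" for b
        have "(\<Sum>b\<in>C. s1 (c b) b) = (\<Sum>b\<in>?D. s1 (c b) b) + (\<Sum>b\<in>B. s1 (c b) b)"
          using sum.subset_diff[OF C(1,5)] by blast
        also have "\<dots> = x - x"
          by (subst (2) w, subst u) (simp add: c_def vs1.scale_minus_left sum_negf)
        finally have "\<forall>b\<in>C. c b = 0" using C(3,5) vs1.independentD by fastforce
        then show ?thesis unfolding u by (auto simp: c_def intro!: sum.neutral)
      qed
      then show ?thesis using vs1.span_zero by blast
    qed
    then show ?thesis using B(3) by simp
  qed
  then have "\<forall>x\<in>vs1.span ?D. f x = 0 \<longrightarrow> x = 0"
    using vs1.span_mono[of ?D C] C(4) by blast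
  then have inj: "inj_on f (vs1.span ?D)"
    using linear_inj_on_iff_eq_0[OF f vs1.subspace_span] by blast
  have ind: "vs2.independent (f ` ?D)"
    using linear_independent_injective_image[OF f _ inj]
      vs1.independent_mono[OF C(3)] by blast
  have "f ` S \<subseteq> vs2.span (f ` ?D)"
  proof -
    have "f ` C \<subseteq> vs2.span (f ` ?D)"
    proof
      fix y assume "y \<in> f ` C"
      then obtain c where c: "c \<in> C" "y = f c" by blast
      show "y \<in> vs2.span (f ` ?D)"
      proof (cases "c \<in> B")
        case True
        then have "y = 0" using B(1) c by blast
        then show ?thesis using vs2.span_zero by simp
      qed (use c in \<open>auto intro: vs2.span_base\<close>)
    qed
    then have "vs2.span (f ` C) \<subseteq> vs2.span (f ` ?D)"
      by (rule vs2.span_minimal[OF _ vs2.subspace_span])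
    then show ?thesis using linear_span_image[OF f, of C] C(4) by simp
  qed
  then have "card (f ` ?D) = vs2.dim (f ` S)"
    using vs2.basis_card_eq_dim[OF _ _ ind] C(2) by blast
  moreover have "card (f ` ?D) = card ?D"
    using inj_on_subset[OF inj vs1.span_superset] card_image by blast
  moreover have "card C = card ?D + card B"
    using C(1,5) card_mono[OF C(5,1)] card_Diff_subset[OF finite_subset[OF C(1,5)] C(1)] by simp
  ultimately show ?thesis using B(4) C(6) by simp
qed

end

lemma subspace_dimension_field: "subspace_dimension ((*) :: 'k::field \<Rightarrow> 'k \<Rightarrow> 'k)"
  by unfold_locales (simp_all add: algebra_simps)

lemma field_findim_dim:
  "subspace_dimension.findim ((*) :: 'k::field \<Rightarrow> 'k \<Rightarrow> 'k) UNIV"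
  "vector_space.dim ((*) :: 'k::field \<Rightarrow> 'k \<Rightarrow> 'k) UNIV = 1"
proof -
  interpret K: subspace_dimension "(*) :: 'k \<Rightarrow> 'k \<Rightarrow> 'k" by (rule subspace_dimension_field)
  have "K.independent {1}" by (simp add: K.dependent_single)
  moreover have K1: "x \<in> K.span {1}" for x
    using K.span_scale[of 1 "{1}" x] K.span_base[of 1 "{1}"] by simp
  ultimately show "K.dim (UNIV :: 'k set) = 1" by (intro K.dim_unique[of "{1}"]) auto
  show "K.findim UNIV" using K1 K.subspace_UNIV by (auto simp: K.findim_def)
qed

section \<open>Tuples\<close>

definition pointwise :: "('k \<Rightarrow> 'v \<Rightarrow> 'v) \<Rightarrow> 'k \<Rightarrow> (nat \<Rightarrow> 'v) \<Rightarrow> (nat \<Rightarrow> 'v)" where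
  "pointwise s c y = (\<lambda>i. s c (y i))"

definition tuples :: "nat \<Rightarrow> 'v::zero set \<Rightarrow> (nat \<Rightarrow> 'v) set" where
  "tuples n S = {y. (\<forall>i<n. y i \<in> S) \<and> (\<forall>i\<ge>n. y i = 0)}"

lemma free_carrier_tuples: "free_carrier n = tuples n UNIV"
  by (auto simp: free_carrier_def tuples_def)

lemma tuples_mono: "S \<subseteq> T \<Longrightarrow> tuples n S \<subseteq> tuples n T"
  by (auto simp: tuples_def)

lemma tuples_nth: "y \<in> tuples n S \<Longrightarrow> 0 \<in> S \<Longrightarrow> y i \<in> S"
  by (cases "i < n") (auto simp: tuples_def)

lemma subspace_dimension_pointwise:
  assumes "subspace_dimension s"
  shows "subspace_dimension (pointwise s)"
proof -
  interpret subspace_dimension s by fact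
  show ?thesis
    by unfold_locales
      (auto simp: pointwise_def fun_eq_iff scale_right_distrib scale_left_distrib)
qed

context subspace_dimension
begin

lemma findim_dim_tuples:
  assumes S: "findim S"
  shows "subspace_dimension.findim (pointwise scale) (tuples n S) \<and>
    vector_space.dim (pointwise scale) (tuples n S) = n * dim S"
proof -
  interpret W: subspace_dimension "pointwise scale"
    by (rule subspace_dimension_pointwise) (rule subspace_dimension_axioms)
  interpret P: subspace_dimension_pair "pointwise scale" scale ..
  have sub: "W.subspace (tuples n S)" for n
    using subspace_add[OF findim_subspace[OF S]] subspace_scale[OF findim_subspace[OF S]]
      subspace_0[OF findim_subspace[OF S]]
    by (auto simp: W.subspace_def tuples_def pointwise_def)
  show ?thesis
  proof (induction n)
    case 0
    have "tuples 0 S = {0}" by (auto simp: tuples_def)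
    then show ?case using W.dim_zero W.findim_zero by simp
  next
    case (Suc n)
    let ?f = "\<lambda>y. y n"
    obtain T where T: "finite T" "tuples n S \<subseteq> W.span T"
      using Suc unfolding W.findim_def by blast
    obtain T' where T': "finite T'" "S \<subseteq> span T'"
      using S unfolding findim_def by blast
    define g where "g x = (\<lambda>i. if i = n then x else 0)" for x :: 'b
    interpret G: Vector_Spaces.linear scale "pointwise scale" g
      by unfold_locales (auto simp: g_def pointwise_def fun_eq_iff)
    have "tuples (Suc n) S \<subseteq> W.span (T \<union> g ` T')"
    proof
      fix y assume y: "y \<in> tuples (Suc n) S"
      then have "y(n := 0) \<in> tuples n S" by (auto simp: tuples_def)
      moreover have "g (y n) \<in> W.span (g ` T')"
        using T' y G.span_image[of T'] by (auto simp: tuples_def)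
      moreover have "y = y(n := 0) + g (y n)" by (auto simp: g_def fun_eq_iff)
      ultimately show "y \<in> W.span (T \<union> g ` T')"
        using T(2) W.span_mono[of T "T \<union> g ` T'"] W.span_mono[of "g ` T'" "T \<union> g ` T'"]
          W.span_add[of "y(n := 0)" "T \<union> g ` T'" "g (y n)"] by auto
    qed
    then have fin: "W.findim (tuples (Suc n) S)"
      using T(1) T'(1) sub unfolding W.findim_def by blast
    have lin: "Vector_Spaces.linear (pointwise scale) scale ?f"
      by unfold_locales (auto simp: pointwise_def)
    have im: "?f ` tuples (Suc n) S = S"
    proof -
      have "x \<in> ?f ` tuples (Suc n) S" if "x \<in> S" for x
        using that subspace_0[OF findim_subspace[OF S]]
        by (intro image_eqI[of _ _ "g x"]) (auto simp: tuples_def g_def)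
      then show ?thesis by (auto simp: tuples_def)
    qed
    have ker: "{y \<in> tuples (Suc n) S. y n = 0} = tuples n S"
    proof (rule subset_antisym; rule subsetI)
      fix y assume "y \<in> {y \<in> tuples (Suc n) S. y n = 0}"
      then have "\<forall>i<n. y i \<in> S" "\<forall>i\<ge>Suc n. y i = 0" "y n = 0" by (auto simp: tuples_def)
      then show "y \<in> tuples n S" by (simp add: tuples_def) (metis le_antisym not_less_eq_eq)
    next
      fix y assume "y \<in> tuples n S"
      then show "y \<in> {y \<in> tuples (Suc n) S. y n = 0}"
        using subspace_0[OF findim_subspace[OF S]] by (simp add: tuples_def less_Suc_eq)
    qed
    have "W.dim (tuples (Suc n) S) = dim S + W.dim (tuples n S)"
      using P.rank_nullity[OF lin fin] by (simp only: im ker)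
    then show ?case using fin Suc.IH by simp
  qed
qed

lemmas findim_tuples = findim_dim_tuples[THEN conjunct1]
  and dim_tuples = findim_dim_tuples[THEN conjunct2]

end

section \<open>Homomorphisms from free modules as tuples\<close>

text \<open>
  The homomorphism from the free module of rank n that sends the unit vectors to g 0, ..., g (n - 1).
  As a formula in v it makes sense, and is linear, on all functions.
\<close>

definition comb :: "('a::ring_1 \<Rightarrow> 'm::ab_group_add \<Rightarrow> 'm) \<Rightarrow> nat \<Rightarrow> (nat \<Rightarrow> 'm) \<Rightarrow> (nat \<Rightarrow> 'a) \<Rightarrow> 'm"
  where "comb act n g v = (\<Sum>l<n. act (v l) (g l))"

definition unit_vector :: "nat \<Rightarrow> nat \<Rightarrow> 'a::ring_1" where
  "unit_vector i = (\<lambda>j. if j = i then 1 else 0)"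

text \<open>
  Homomorphisms as in hom_on, but without the convention on the values outside X. Thus restrictions and
  composites of homomorphisms are given by the plain functions.
\<close>

definition module_map ::
  "'b::ab_group_add set \<Rightarrow> ('a::ring_1 \<Rightarrow> 'b \<Rightarrow> 'b) \<Rightarrow>
   'c::ab_group_add set \<Rightarrow> ('a \<Rightarrow> 'c \<Rightarrow> 'c) \<Rightarrow> ('b \<Rightarrow> 'c) \<Rightarrow> bool" where
  "module_map X actX Y actY f \<longleftrightarrow>
     (\<forall>x\<in>X. f x \<in> Y) \<and> (\<forall>x\<in>X. \<forall>y\<in>X. f (x + y) = f x + f y) \<and>
     (\<forall>a. \<forall>x\<in>X. f (actX a x) = actY a (f x))"

lemma hom_on_module_map: "f \<in> hom_on X actX Y actY \<Longrightarrow> module_map X actX Y actY f"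
  by (auto simp: hom_on_def module_map_def)

lemma unit_vector_free_carrier: "i < n \<Longrightarrow> unit_vector i \<in> free_carrier n"
  by (auto simp: unit_vector_def free_carrier_def)

lemma submod_diff:
  assumes "left_module act" "submod act S" "x \<in> S" "y \<in> S"
  shows "x - y \<in> S"
proof -
  interpret left_module act by fact
  have "act (- 1) y = - y" using act_add_left[of 1 "- 1" y]
    by (simp add: act_zero_left act_one minus_unique)
  then have "- y \<in> S" using submod_closed(3)[OF assms(2,4), of "- 1"] by simp
  then show ?thesis using submod_closed(2)[OF assms(2,3), of "- y"] by simp
qed

context left_module
begin

lemma comb_add: "comb act n g (v + w) = comb act n g v + comb act n g w"
  by (simp add: comb_def act_add_left sum.distrib)

lemma comb_act: "comb act n g (free_act a v) = act a (comb act n g v)"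
  by (simp add: comb_def free_act_def act_sum act_act)

lemma comb_zero: "comb act n g 0 = 0"
  by (simp add: comb_def act_zero_left)

lemma comb_diff: "comb act n g (v - w) = comb act n g v - comb act n g w"
  using comb_add[of n g "v - w" w] by simp

lemma comb_add_tuple: "comb act n (\<lambda>l. g l + h l) v = comb act n g v + comb act n h v"
  by (simp add: comb_def act_add_right sum.distrib)

lemma comb_diff_tuple: "comb act n (\<lambda>l. g l - h l) v = comb act n g v - comb act n h v"
  using comb_add_tuple[of n "\<lambda>l. g l - h l" h v] by simp

lemma comb_unit:
  assumes "i < n"
  shows "comb act n g (unit_vector i) = g i"
proof -
  have "comb act n g (unit_vector i) = (\<Sum>l<n. if l = i then g l else 0)"
    unfolding comb_def by (rule sum.cong) (auto simp: unit_vector_def act_one act_zero_left)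
  then show ?thesis using assms by simp
qed

lemma comb_in:
  assumes "submod act S" "\<And>l. l < n \<Longrightarrow> g l \<in> S"
  shows "comb act n g v \<in> S"
  unfolding comb_def by (intro submod_sum[OF assms(1)] submod_closed(3)[OF assms(1)]) (use assms in auto)

lemma comb_cong: "(\<And>l. l < n \<Longrightarrow> g l = h l) \<Longrightarrow> comb act n g v = comb act n h v"
  unfolding comb_def by (rule sum.cong) auto

lemma comb_sum: "finite I \<Longrightarrow> comb act n g (\<Sum>i\<in>I. f i) = (\<Sum>i\<in>I. comb act n g (f i))"
proof (induction I rule: finite_induct)
  case (insert i I)
  then show ?case by (simp only: sum.insert[OF insert.hyps] comb_add)
qed (simp only: sum.empty comb_zero)

lemma comb_comb: "comb act n g (comb free_act m h v) = comb act m (\<lambda>l. comb act n g (h l)) v"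
  unfolding comb_def[of free_act] by (simp add: comb_sum comb_act) (simp add: comb_def)

lemma module_map_comb:
  assumes "submod act S" "\<And>l. l < n \<Longrightarrow> g l \<in> S"
  shows "module_map X free_act S act (comb act n g)"
  using comb_in[OF assms] by (auto simp: module_map_def comb_add comb_act)

end

lemma module_map_zero:
  assumes "module_map X actX Y actY f" "submod actX X"
  shows "f 0 = 0"
proof -
  have "f (0 + 0) = f 0 + f 0"
    using assms submod_closed(1)[OF assms(2)] unfolding module_map_def by blast
  then show ?thesis by simp
qed

lemma module_map_sum:
  assumes "module_map X actX Y actY f" "submod actX X" "\<And>i. i \<in> I \<Longrightarrow> h i \<in> X" "finite I"
  shows "f (\<Sum>i\<in>I. h i) = (\<Sum>i\<in>I. f (h i))"
  using assms(4,3)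
proof (induction I rule: finite_induct)
  case empty
  then show ?case using module_map_zero[OF assms(1,2)] by simp
next
  case (insert i I)
  moreover have "sum h I \<in> X" by (rule submod_sum[OF assms(2)]) (use insert in auto)
  ultimately show ?case using assms(1) by (simp add: module_map_def)
qed

lemma module_map_of_comb:
  assumes "module_map X actX Y actY f" "submod actX X" "\<And>l. l < n \<Longrightarrow> g l \<in> X"
  shows "f (comb actX n g v) = comb actY n (\<lambda>l. f (g l)) v"
proof -
  have "f (comb actX n g v) = (\<Sum>l<n. f (actX (v l) (g l)))"
    unfolding comb_def
    by (rule module_map_sum[OF assms(1,2)]) (auto intro: submod_closed(3)[OF assms(2)] assms(3))
  also have "\<dots> = comb actY n (\<lambda>l. f (g l)) v"
    using assms(1,3) by (simp add: comb_def module_map_def)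
  finally show ?thesis .
qed

lemma comb_coordinate: "comb free_act n g v i = comb regular_act n (\<lambda>l. g l i) v"
  unfolding comb_def by (induction n) (simp_all add: free_act_def)

lemma comb_unit_vector: "(v :: nat \<Rightarrow> 'a::ring_1) \<in> free_carrier n \<Longrightarrow> comb free_act n unit_vector v = v"
proof
  fix i assume v: "v \<in> free_carrier n"
  have "comb free_act n unit_vector v i = (\<Sum>l<n. if l = i then v l else 0)"
    unfolding comb_coordinate unfolding comb_def by (rule sum.cong) (auto simp: unit_vector_def)
  then show "comb free_act n unit_vector v i = v i"
    using v by (simp add: free_carrier_def)
qed

lemma module_map_free_eq_comb:
  assumes "module_map (free_carrier n) free_act Y actY f" "v \<in> free_carrier n"
  shows "f v = comb actY n (\<lambda>l. f (unit_vector l)) v"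
proof -
  have "f (comb free_act n unit_vector v) = comb actY n (\<lambda>l. f (unit_vector l)) v"
    by (rule module_map_of_comb[OF assms(1) submod_free_carrier]) (rule unit_vector_free_carrier)
  then show ?thesis by (simp only: comb_unit_vector[OF assms(2)])
qed

section \<open>Free covers and the extension of homomorphisms\<close>

definition covers :: "('a::ring_1 \<Rightarrow> 'm::ab_group_add \<Rightarrow> 'm) \<Rightarrow> nat \<Rightarrow> (nat \<Rightarrow> 'm) \<Rightarrow> 'm set \<Rightarrow> bool"
  where "covers act n g X \<longleftrightarrow> (\<forall>l<n. g l \<in> X) \<and> X \<subseteq> comb act n g ` free_carrier n"

text \<open>
  A first syzygy of X, if g generates X.
\<close>

definition relations :: "('a::ring_1 \<Rightarrow> 'm::ab_group_add \<Rightarrow> 'm) \<Rightarrow> nat \<Rightarrow> (nat \<Rightarrow> 'm) \<Rightarrow> (nat \<Rightarrow> 'a) set"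
  where "relations act n g = {v \<in> free_carrier n. comb act n g v = 0}"

text \<open>
  For a submodule K of the free module F of rank n this says that Ext^1(F/K, N) = 0: the homomorphisms
  from F to N are given by the tuples y in N.
\<close>

definition homs_extend ::
  "nat \<Rightarrow> (nat \<Rightarrow> 'a::ring_1) set \<Rightarrow> 'n::ab_group_add set \<Rightarrow> ('a \<Rightarrow> 'n \<Rightarrow> 'n) \<Rightarrow> bool" where
  "homs_extend n K N act \<longleftrightarrow>
     (\<forall>f. module_map K free_act N act f \<longrightarrow>
        (\<exists>y. (\<forall>l<n. y l \<in> N) \<and> (\<forall>x\<in>K. comb act n y x = f x)))"

lemma coversE:
  assumes "covers act n g X" "x \<in> X"
  obtains v where "v \<in> free_carrier n" "comb act n g v = x"
  using assms by (auto simp: covers_def)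

lemma covers_choose:
  assumes "covers act n g X" "\<And>l. l < m \<Longrightarrow> x l \<in> X"
  obtains u where "\<And>l. l < m \<Longrightarrow> u l \<in> free_carrier n" "\<And>l. l < m \<Longrightarrow> comb act n g (u l) = x l"
proof -
  have "\<forall>l. \<exists>u. l < m \<longrightarrow> u \<in> free_carrier n \<and> comb act n g u = x l"
    using assms by (meson coversE)
  then show ?thesis using that by metis
qed

context left_module
begin

lemma submod_relations: "submod free_act (relations act n g)"
  using submod_closed[OF submod_free_carrier[of n]]
  by (auto simp: submod_def relations_def comb_zero comb_add comb_act act_zero_right)

lemma factor_through_cover:
  assumes "left_module actK" and K: "submod actK K" and g: "covers actK n g K"
    and S: "submod act S" and z: "\<And>l. l < n \<Longrightarrow> z l \<in> S"
    and kills: "\<And>v. v \<in> relations actK n g \<Longrightarrow> comb act n z v = 0"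
  obtains f where "module_map K actK S act f"
    "\<And>v. v \<in> free_carrier n \<Longrightarrow> f (comb actK n g v) = comb act n z v"
proof -
  interpret K: left_module actK by fact
  note F = submod_closed[OF submod_free_carrier[of n]]
  have wd: "comb act n z v = comb act n z w"
    if "v \<in> free_carrier n" "w \<in> free_carrier n" "comb actK n g v = comb actK n g w" for v w
  proof -
    have "v - w \<in> relations actK n g"
      using that submod_diff[OF left_module_free_act submod_free_carrier that(1,2)]
      by (simp add: relations_def K.comb_diff)
    then show ?thesis using kills[of "v - w"] by (simp add: comb_diff)
  qed
  define c where "c x = (SOME v. v \<in> free_carrier n \<and> comb actK n g v = x)" for x
  have c: "c x \<in> free_carrier n \<and> comb actK n g (c x) = x" if "x \<in> K" for x
  proof -
    obtain v where "v \<in> free_carrier n" "comb actK n g v = x" by (rule coversE[OF g \<open>x \<in> K\<close>])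
    then have "\<exists>v. v \<in> free_carrier n \<and> comb actK n g v = x" by blast
    from someI_ex[OF this] show ?thesis unfolding c_def .
  qed
  define f where "f x = comb act n z (c x)" for x
  have fg: "f x = comb act n z v" if "x \<in> K" "v \<in> free_carrier n" "comb actK n g v = x" for x v
    unfolding f_def by (rule wd) (use c that in auto)
  have "module_map K actK S act f"
    unfolding module_map_def
  proof (intro conjI ballI allI)
    fix x y a assume x: "x \<in> K"
    show "f x \<in> S" unfolding f_def by (rule comb_in[OF S z])
    show "f (actK a x) = act a (f x)"
      using fg[OF submod_closed(3)[OF K x] F(3)[of "c x" a]] c[OF x]
      by (simp add: K.comb_act comb_act f_def)
    assume y: "y \<in> K"
    show "f (x + y) = f x + f y"
      using fg[OF submod_closed(2)[OF K x y] F(2)[of "c x" "c y"]] c[OF x] c[OF y]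
      by (simp add: K.comb_add comb_add f_def)
  qed
  moreover have "f (comb actK n g v) = comb act n z v" if "v \<in> free_carrier n" for v
    using fg[OF K.comb_in[OF K] that] g by (auto simp: covers_def)
  ultimately show ?thesis using that by blast
qed


text \<open>
  The cohomology at F' of the complex of homomorphisms into N vanishes, when F'' --> F' --> F is
  exact and homomorphisms into N extend from the image of F' to F.
\<close>

lemma cocycle_is_coboundary:
  assumes "homs_extend t K N act" "submod act N" "submod free_act K"
    and g: "covers free_act t' g K" and g': "covers free_act t'' g' (relations free_act t' g)"
    and z: "\<And>l. l < t' \<Longrightarrow> z l \<in> N" and cocycle: "\<And>l. l < t'' \<Longrightarrow> comb act t' z (g' l) = 0"
  obtains y where "\<And>l. l < t \<Longrightarrow> y l \<in> N" "\<And>l. l < t' \<Longrightarrow> comb act t y (g l) = z l"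
proof -
  have "comb act t' z v = 0" if v: "v \<in> relations free_act t' g" for v
  proof -
    obtain w where w: "comb free_act t'' g' w = v" by (rule coversE[OF g' v])
    have "comb act t' z v = comb act t'' (\<lambda>l. comb act t' z (g' l)) w"
      unfolding w[symmetric] by (rule comb_comb)
    also have "\<dots> = comb act t'' (\<lambda>l. 0) w" by (rule comb_cong) (rule cocycle)
    finally show ?thesis by (simp add: comb_def act_zero_right)
  qed
  then obtain f where f: "module_map K free_act N act f"
    "\<And>v. v \<in> free_carrier t' \<Longrightarrow> f (comb free_act t' g v) = comb act t' z v"
    using factor_through_cover[OF left_module_free_act assms(3) g assms(2), of z] z by blast
  obtain y where y: "\<forall>l<t. y l \<in> N" "\<forall>x\<in>K. comb act t y x = f x"
    using assms(1) f(1) unfolding homs_extend_def by blast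
  have "comb act t y (g l) = z l" if "l < t'" for l
    using y(2) g that f(2)[OF unit_vector_free_carrier[OF that]]
    by (simp add: covers_def comb_unit left_module.comb_unit[OF left_module_free_act])
  with y(1) show ?thesis by (intro that[of y]) simp_all
qed

text \<open>
  Dimension shift in both arguments: if Ext(-, A) vanishes, then Ext(K, X) = 0 implies
  Ext(K', Y) = 0 for the first syzygies K' of K and Y of X. A homomorphism from K' to Y extends to a
  homomorphism between the free covers, which induces one from K to X; this extends, and
  subtracting a lift of the extension gives values in Y.
\<close>

lemma homs_extend_shift:
  assumes X: "submod act X" and p: "covers act m p X"
    and K: "submod free_act K" and g: "covers free_act t' g K"
    and ext: "homs_extend t K X act"
    and ext_A: "homs_extend t' (relations free_act t' g) UNIV regular_act"
  shows "homs_extend t' (relations free_act t' g) (relations act m p) free_act"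
  unfolding homs_extend_def
proof (intro allI impI)
  let ?K' = "relations free_act t' g" and ?Y = "relations act m p"
  interpret F: left_module free_act by (rule left_module_free_act)
  fix f assume f: "module_map ?K' free_act ?Y free_act f"
  have "\<exists>y. \<forall>x\<in>?K'. comb regular_act t' y x = f x i" for i
  proof -
    have "module_map ?K' free_act UNIV regular_act (\<lambda>x. f x i)"
      using f by (auto simp: module_map_def free_act_def)
    then show ?thesis using ext_A unfolding homs_extend_def by blast
  qed
  then have "\<exists>y. \<forall>i. \<forall>x\<in>?K'. comb regular_act t' (y i) x = f x i" by (rule choice[OF allI])
  then obtain y where y: "\<And>i x. x \<in> ?K' \<Longrightarrow> comb regular_act t' (y i) x = f x i" by blast
  define G where "G l = (\<lambda>i. if i < m then y i l else 0)" for l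
  have G: "comb free_act t' G x = f x" if "x \<in> ?K'" for x
  proof
    fix i
    have "f x \<in> free_carrier m" using f that by (auto simp: module_map_def relations_def)
    then have "f x i = 0" if "\<not> i < m" using that by (simp add: free_carrier_def)
    then show "comb free_act t' G x i = f x i"
      unfolding comb_coordinate using y[OF that, of i]
      by (cases "i < m") (auto simp: G_def comb_def)
  qed
  have G_carrier: "G l \<in> free_carrier m" for l by (simp add: G_def free_carrier_def)
  define z where "z l = comb act m p (G l)" for l
  have z: "z l \<in> X" for l
    unfolding z_def using comb_in[OF X] p by (auto simp: covers_def)
  have "comb act t' z v = 0" if "v \<in> ?K'" for v
  proof -
    have "comb act t' z v = comb act m p (comb free_act t' G v)"
      unfolding z_def comb_comb ..
    moreover have "f v \<in> ?Y" using f that by (auto simp: module_map_def)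
    ultimately show ?thesis using G[OF that] by (simp add: relations_def)
  qed
  then obtain \<phi> where \<phi>: "module_map K free_act X act \<phi>"
    "\<And>v. v \<in> free_carrier t' \<Longrightarrow> \<phi> (comb free_act t' g v) = comb act t' z v"
    using factor_through_cover[OF left_module_free_act K g X, of z] z by blast
  obtain e where e: "\<forall>l<t. e l \<in> X" "\<forall>x\<in>K. comb act t e x = \<phi> x"
    using ext \<phi>(1) unfolding homs_extend_def by blast
  obtain h where h: "\<And>l. l < t \<Longrightarrow> h l \<in> free_carrier m" "\<And>l. l < t \<Longrightarrow> comb act m p (h l) = e l"
    using covers_choose[OF p, of t e] e(1) by blast
  have gK: "g l \<in> K" if "l < t'" for l using g that by (simp add: covers_def)
  let ?y = "\<lambda>l. G l - comb free_act t h (g l)"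
  have "?y l \<in> ?Y" if l: "l < t'" for l
  proof -
    have "comb act m p (comb free_act t h (g l)) = comb act t e (g l)"
      unfolding comb_comb by (rule comb_cong) (rule h(2))
    also have "\<dots> = \<phi> (comb free_act t' g (unit_vector l))"
      using e(2) gK[OF l] by (simp only: F.comb_unit[OF l])
    also have "\<dots> = z l" using \<phi>(2)[OF unit_vector_free_carrier[OF l]] comb_unit[OF l] by simp
    finally show ?thesis
      using submod_diff[OF F.left_module_axioms submod_free_carrier G_carrier]
        F.comb_in[OF submod_free_carrier h(1)]
      by (simp add: relations_def comb_diff z_def)
  qed
  moreover have "comb free_act t' ?y x = f x" if "x \<in> ?K'" for x
  proof -
    have "comb free_act t' (\<lambda>l. comb free_act t h (g l)) x = comb free_act t h (comb free_act t' g x)"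
      by (simp only: F.comb_comb)
    also have "\<dots> = 0" using that by (simp only: relations_def mem_Collect_eq F.comb_zero)
    finally show ?thesis using G[OF that] by (simp only: F.comb_diff_tuple diff_zero)
  qed
  ultimately show "\<exists>y. (\<forall>l<t'. y l \<in> ?Y) \<and> (\<forall>x\<in>?K'. comb free_act t' y x = f x)"
    by (intro exI[of _ ?y]) simp
qed

end

section \<open>Independence of the resolution\<close>

text \<open>
  K and L are submodules of free modules of ranks n and m. The homomorphisms u and v between the
  free modules restrict to homomorphisms between K and L, and on L the composite uv differs from the
  identity by a homomorphism w from the whole free module of rank m to L.
\<close>

definition stably_related ::
  "nat \<Rightarrow> (nat \<Rightarrow> 'a::ring_1) set \<Rightarrow> nat \<Rightarrow> (nat \<Rightarrow> 'a) set \<Rightarrow> bool" where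
  "stably_related n K m L \<longleftrightarrow>
     (\<exists>u v w. (\<forall>l<m. w l \<in> L) \<and>
        (\<forall>x\<in>K. comb free_act n u x \<in> L) \<and> (\<forall>x\<in>L. comb free_act m v x \<in> K) \<and>
        (\<forall>x\<in>L. x = comb free_act n u (comb free_act m v x) + comb free_act m w x))"

text \<open>
  On L, a homomorphism f is the sum of (f u) v, where f u extends from K, and of f w, which is defined on
  the whole free module.
\<close>

lemma homs_extend_transfer:
  assumes "left_module act" "submod act N"
    and rel: "stably_related n K m L" and L: "submod free_act L"
    and ext: "homs_extend n K N act"
  shows "homs_extend m L N act"
  unfolding homs_extend_def
proof (intro allI impI)
  interpret left_module act by fact
  interpret F: left_module free_act by (rule left_module_free_act)
  fix f assume f: "module_map L free_act N act f"
  obtain u v w where w: "\<And>l. l < m \<Longrightarrow> w l \<in> L"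
    and uK: "\<And>x. x \<in> K \<Longrightarrow> comb free_act n u x \<in> L" and vL: "\<And>x. x \<in> L \<Longrightarrow> comb free_act m v x \<in> K"
    and uv: "\<And>x. x \<in> L \<Longrightarrow> x = comb free_act n u (comb free_act m v x) + comb free_act m w x"
    using rel unfolding stably_related_def by metis
  have "module_map K free_act N act (\<lambda>x. f (comb free_act n u x))"
    using f uK by (auto simp: module_map_def F.comb_add F.comb_act)
  then obtain y where y: "\<And>l. l < n \<Longrightarrow> y l \<in> N"
    "\<And>x. x \<in> K \<Longrightarrow> comb act n y x = f (comb free_act n u x)"
    using ext unfolding homs_extend_def by blast
  let ?z = "\<lambda>l. comb act n y (v l) + f (w l)"
  have "?z l \<in> N" if "l < m" for l
    using submod_closed(2)[OF assms(2) comb_in[OF assms(2) y(1)]] f w[OF that]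
    by (auto simp: module_map_def)
  moreover have "comb act m ?z x = f x" if x: "x \<in> L" for x
  proof -
    have "comb act m ?z x = f (comb free_act n u (comb free_act m v x)) + f (comb free_act m w x)"
      unfolding comb_add_tuple
      using y(2)[OF vL[OF x]] module_map_of_comb[OF f L, of m w x] w by (simp add: comb_comb)
    also have "\<dots> = f (comb free_act n u (comb free_act m v x) + comb free_act m w x)"
      using f uK[OF vL[OF x]] F.comb_in[OF L w] by (simp add: module_map_def)
    finally show ?thesis using uv[OF x] by simp
  qed
  ultimately show "\<exists>y. (\<forall>l<m. y l \<in> N) \<and> (\<forall>x\<in>L. comb act m y x = f x)"
    by (intro exI[of _ ?z]) simp
qed

text \<open>
  The comparison theorem for one step of two resolutions. If U V differs from the identity by a map
  q S through the free cover of X', then the lifts u and v of U and V to the free covers differ from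
  inverse maps, u v - 1 + S q, by a map into the kernel of q, and S q vanishes on that kernel.
\<close>

lemma stably_related_relations:
  fixes act :: "'a::ring_1 \<Rightarrow> 'm::ab_group_add \<Rightarrow> 'm"
  assumes "left_module act" and X: "submod act X" and X': "submod act' X'" and "left_module act'"
    and p: "covers act n p X" and q: "covers act' m q X'"
    and U: "module_map X act X' act' U" and V: "module_map X' act' X act V"
    and S: "module_map X' act' (free_carrier m) free_act S"
    and UV: "\<And>x. x \<in> X' \<Longrightarrow> x = U (V x) + comb act' m q (S x)"
  shows "stably_related n (relations act n p) m (relations act' m q)"
proof -
  interpret M: left_module act by fact
  interpret N: left_module act' by fact
  interpret F: left_module free_act by (rule left_module_free_act)
  have pX: "p l \<in> X" if "l < n" for l using p that by (simp add: covers_def)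
  have qX: "q l \<in> X'" if "l < m" for l using q that by (simp add: covers_def)
  obtain u where u: "\<And>l. l < n \<Longrightarrow> u l \<in> free_carrier m"
      "\<And>l. l < n \<Longrightarrow> comb act' m q (u l) = U (p l)"
    using covers_choose[OF q, of n "\<lambda>l. U (p l)"] U pX by (auto simp: module_map_def)
  obtain v where v: "\<And>l. l < m \<Longrightarrow> v l \<in> free_carrier n"
      "\<And>l. l < m \<Longrightarrow> comb act n p (v l) = V (q l)"
    using covers_choose[OF p, of m "\<lambda>l. V (q l)"] V qX by (auto simp: module_map_def)
  have qu: "comb act' m q (comb free_act n u x) = U (comb act n p x)" for x
  proof -
    have "U (comb act n p x) = comb act' n (\<lambda>l. U (p l)) x"
      by (rule module_map_of_comb[OF U X pX])
    moreover have "comb act' n (\<lambda>l. comb act' m q (u l)) x = comb act' n (\<lambda>l. U (p l)) x"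
      by (rule N.comb_cong) (rule u(2))
    ultimately show ?thesis by (simp only: N.comb_comb)
  qed
  have pv: "comb act n p (comb free_act m v x) = V (comb act' m q x)" for x
  proof -
    have "V (comb act' m q x) = comb act m (\<lambda>l. V (q l)) x"
      by (rule module_map_of_comb[OF V X' qX])
    moreover have "comb act m (\<lambda>l. comb act n p (v l)) x = comb act m (\<lambda>l. V (q l)) x"
      by (rule M.comb_cong) (rule v(2))
    ultimately show ?thesis by (simp only: M.comb_comb)
  qed
  define w where "w = (\<lambda>l. unit_vector l - comb free_act n u (v l) - S (q l))"
  have uF: "comb free_act n u x \<in> free_carrier m" for x by (rule F.comb_in[OF submod_free_carrier u(1)])
  have vF: "comb free_act m v x \<in> free_carrier n" for x by (rule F.comb_in[OF submod_free_carrier v(1)])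
  have SF: "S x \<in> free_carrier m" if "x \<in> X'" for x using S that by (simp add: module_map_def)
  note diff = submod_diff[OF F.left_module_axioms submod_free_carrier]
  have wL: "w l \<in> relations act' m q" if l: "l < m" for l
  proof -
    have "w l \<in> free_carrier m"
      unfolding w_def by (intro diff unit_vector_free_carrier l uF SF qX)
    moreover have "q l - U (V (q l)) = comb act' m q (S (q l))"
      using UV[OF qX[OF l]] by (simp add: diff_eq_eq add.commute)
    ultimately show ?thesis
      by (simp add: relations_def w_def N.comb_diff N.comb_unit[OF l] qu v(2)[OF l])
  qed
  have comb_w: "comb free_act m w x = x - comb free_act n u (comb free_act m v x) - S (comb act' m q x)"
    if "x \<in> free_carrier m" for x
  proof -
    have "S (comb act' m q x) = comb free_act m (\<lambda>l. S (q l)) x"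
      by (rule module_map_of_comb[OF S X' qX])
    then show ?thesis
      by (simp only: w_def F.comb_diff_tuple comb_unit_vector[OF that] F.comb_comb)
  qed
  show ?thesis
    unfolding stably_related_def
  proof (rule exI[of _ u], rule exI[of _ v], rule exI[of _ w], intro conjI ballI allI impI)
    fix x assume x: "x \<in> relations act' m q"
    then have "S (comb act' m q x) = 0"
      using module_map_zero[OF S X'] by (simp add: relations_def)
    moreover have "x \<in> free_carrier m" using x by (simp add: relations_def)
    ultimately show "x = comb free_act n u (comb free_act m v x) + comb free_act m w x"
      using comb_w[of x] by (metis add.commute diff_add_cancel diff_zero)
    show "comb free_act m v x \<in> relations act n p"
      using x pv[of x] vF module_map_zero[OF V X'] by (simp add: relations_def)
  next
    fix x assume "x \<in> relations act n p"
    then show "comb free_act n u x \<in> relations act' m q"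
      using qu[of x] uF module_map_zero[OF U X] by (simp add: relations_def)
  qed (rule wL)
qed

text \<open>A free resolution, recorded by the syzygies K j and the rows g j of its matrices.\<close>

definition free_chain ::
  "('a::ring_1 \<Rightarrow> 'm::ab_group_add \<Rightarrow> 'm) \<Rightarrow> (nat \<Rightarrow> nat) \<Rightarrow> (nat \<Rightarrow> (nat \<Rightarrow> 'a) set) \<Rightarrow>
   (nat \<Rightarrow> 'm) \<Rightarrow> (nat \<Rightarrow> nat \<Rightarrow> nat \<Rightarrow> 'a) \<Rightarrow> bool" where
  "free_chain act t K e g \<longleftrightarrow>
     covers act (t 0) e UNIV \<and> K 0 = relations act (t 0) e \<and>
     (\<forall>j. covers free_act (t (Suc j)) (g j) (K j) \<and> K (Suc j) = relations free_act (t (Suc j)) (g j))"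

lemma free_chain_submod:
  assumes "left_module act" "free_chain act t K e g"
  shows "submod free_act (K j)"
  using assms left_module.submod_relations[OF assms(1)]
    left_module.submod_relations[OF left_module_free_act]
  by (cases j) (simp_all add: free_chain_def)

lemma free_chains_stably_related:
  assumes "left_module act" "free_chain act t K e g" "free_chain act t' K' e' g'"
  shows "stably_related (t j) (K j) (t' j) (K' j)"
proof (induction j)
  case 0
  interpret left_module act by fact
  note F = submod_closed(1)[OF submod_free_carrier]
  have "stably_related (t 0) (relations act (t 0) e) (t' 0) (relations act (t' 0) e')"
    by (rule stably_related_relations[OF assms(1) submod_UNIV submod_UNIV assms(1),
          where U = "\<lambda>x. x" and V = "\<lambda>x. x" and S = "\<lambda>x. 0"])
      (use assms F in \<open>auto simp: free_chain_def module_map_def comb_zero free_act_def fun_eq_iff\<close>)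
  then show ?case using assms by (simp add: free_chain_def)
next
  case (Suc j)
  interpret F: left_module free_act by (rule left_module_free_act)
  have g: "covers free_act (t (Suc j)) (g j) (K j)" "covers free_act (t' (Suc j)) (g' j) (K' j)"
    using assms by (auto simp: free_chain_def)
  note K = free_chain_submod[OF assms(1,2), of j] and K' = free_chain_submod[OF assms(1,3), of j]
  obtain u v w where u: "\<And>x. x \<in> K j \<Longrightarrow> comb free_act (t j) u x \<in> K' j"
    and v: "\<And>x. x \<in> K' j \<Longrightarrow> comb free_act (t' j) v x \<in> K j"
    and w: "\<And>l. l < t' j \<Longrightarrow> w l \<in> K' j"
    and uv: "\<And>x. x \<in> K' j \<Longrightarrow>
      x = comb free_act (t j) u (comb free_act (t' j) v x) + comb free_act (t' j) w x"
    using Suc unfolding stably_related_def by metis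
  obtain s where s: "\<And>l. l < t' j \<Longrightarrow> s l \<in> free_carrier (t' (Suc j))"
    "\<And>l. l < t' j \<Longrightarrow> comb free_act (t' (Suc j)) (g' j) (s l) = w l"
    using covers_choose[OF g(2), of "t' j" w] w by blast
  have "stably_related (t (Suc j)) (relations free_act (t (Suc j)) (g j))
      (t' (Suc j)) (relations free_act (t' (Suc j)) (g' j))"
  proof (rule stably_related_relations[OF F.left_module_axioms K K' F.left_module_axioms g,
        where U = "comb free_act (t j) u" and V = "comb free_act (t' j) v" and S = "comb free_act (t' j) s"])
    show "module_map (K' j) free_act (free_carrier (t' (Suc j))) free_act (comb free_act (t' j) s)"
      by (rule F.module_map_comb[OF submod_free_carrier s(1)])
    show "x = comb free_act (t j) u (comb free_act (t' j) v x) +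
        comb free_act (t' (Suc j)) (g' j) (comb free_act (t' j) s x)" if "x \<in> K' j" for x
    proof -
      have "comb free_act (t' (Suc j)) (g' j) (comb free_act (t' j) s x) = comb free_act (t' j) w x"
        unfolding F.comb_comb by (rule F.comb_cong) (rule s(2))
      then show ?thesis using uv[OF that] by simp
    qed
  qed (use u v in \<open>auto simp: module_map_def F.comb_add F.comb_act\<close>)
  then show ?case using assms by (simp add: free_chain_def)
qed

section \<open>Short local algebras\<close>

sublocale fd_algebra \<subseteq> subspace_dimension scale ..

context fd_algebra
begin

lemma findim_UNIV: "findim UNIV"
  using finite_dim by (auto simp: findim_def subspace_UNIV)

lemma findim_subspaceI: "subspace S \<Longrightarrow> findim S"
  using findim_mono[OF findim_UNIV] by blast

end

context local_algebra
begin

lemma submod_radical: "submod regular_act (radical :: 'a set)"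
  by (simp add: radical_def submod_def maximal_left_ideal_def)

lemma radical_closed:
  "0 \<in> (radical :: 'a set)"
  "x \<in> (radical :: 'a set) \<Longrightarrow> y \<in> radical \<Longrightarrow> x + y \<in> radical"
  "x \<in> (radical :: 'a set) \<Longrightarrow> a * x \<in> radical"
  "x \<in> (radical :: 'a set) \<Longrightarrow> scale c x \<in> radical"
proof -
  note R = submod_closed[OF submod_radical]
  show "0 \<in> (radical :: 'a set)" by (rule R(1))
  show "x \<in> (radical :: 'a set) \<Longrightarrow> y \<in> radical \<Longrightarrow> x + y \<in> radical" by (rule R(2))
  show mult: "x \<in> (radical :: 'a set) \<Longrightarrow> a * x \<in> radical" for a x by (rule R(3))
  show "x \<in> (radical :: 'a set) \<Longrightarrow> scale c x \<in> radical"
    using mult[of x "scale c 1"] by (simp only: scale_one_mult)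
qed

lemma subspace_radical: "subspace (radical :: 'a set)"
  unfolding subspace_def using radical_closed by blast

lemma one_notin_radical: "1 \<notin> (radical :: 'a set)"
proof
  assume one: "1 \<in> (radical :: 'a set)"
  obtain I :: "'a set" where I: "maximal_left_ideal I" using local_ring by blast
  then have "1 \<in> I" using one unfolding radical_def by blast
  then have "a \<in> I" for a
    using submod_closed(3)[of regular_act I 1 a] I by (simp add: maximal_left_ideal_def)
  then show False using I by (auto simp: maximal_left_ideal_def)
qed

lemma residue:
  fixes a :: 'a
  obtains c y where "y \<in> radical" "a = scale c 1 + y"
proof -
  obtain c where "a - scale c 1 \<in> radical" using residue_field by blast
  then show ?thesis using that[of "a - scale c 1" c] by simp
qed

text \<open>The radical is a two-sided ideal, because A is spanned by it and the central element 1.\<close>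

lemma radical_mult_right:
  assumes "x \<in> (radical :: 'a set)"
  shows "x * a \<in> radical"
proof -
  obtain c y where y: "y \<in> radical" "a = scale c 1 + y" by (rule residue)
  have "x * a = scale c x + x * y" by (simp add: y(2) distrib_left flip: scale_mult_right)
  then show ?thesis using radical_closed assms y(1) by simp
qed

lemma dim_radical: "dim (UNIV :: 'a set) = Suc (dim (radical :: 'a set))"
proof -
  interpret K: subspace_dimension "(*) :: 'k \<Rightarrow> 'k \<Rightarrow> 'k"
    by (rule subspace_dimension_field)
  interpret P: subspace_dimension_pair scale "(*) :: 'k \<Rightarrow> 'k \<Rightarrow> 'k" ..
  define f where "f a = (THE c. a - scale c 1 \<in> radical)" for a :: 'a
  have f: "a - scale c 1 \<in> radical \<longleftrightarrow> f a = c" for a c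
    unfolding f_def using residue_field by (metis (no_types, lifting) the1_equality)
  have lin: "Vector_Spaces.linear scale ((*) :: 'k \<Rightarrow> 'k \<Rightarrow> 'k) f"
  proof unfold_locales
    fix a b :: 'a and c :: 'k
    have a: "a - scale (f a) 1 \<in> radical" and b: "b - scale (f b) 1 \<in> radical" using f by auto
    have "(a - scale (f a) 1) + (b - scale (f b) 1) = (a + b) - scale (f a + f b) 1"
      by (simp add: scale_left_distrib)
    then show "f (a + b) = f a + f b" using radical_closed(2)[OF a b] f by (simp only:)
    have "scale c (a - scale (f a) 1) = scale c a - scale (c * f a) 1"
      by (simp add: scale_right_diff_distrib)
    then show "f (scale c a) = c * f a" using radical_closed(4)[OF a, of c] f by (simp only:)
  qed
  have "f (scale c 1) = c" for c using f[of "scale c 1" c] radical_closed(1) by simp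
  then have im: "range f = (UNIV :: 'k set)" by (metis surj_def)
  have ker: "{a \<in> UNIV. f a = 0} = radical" using f[of _ 0] by auto
  show ?thesis
    using P.rank_nullity[OF lin findim_UNIV] field_findim_dim(2)[where ?'k = 'k]
    unfolding im ker by simp
qed

end

definition left_socle :: "('a::ring_1 \<Rightarrow> 'm::ab_group_add \<Rightarrow> 'm) \<Rightarrow> 'm set \<Rightarrow> 'm set" where
  "left_socle act X = {x \<in> X. \<forall>y\<in>radical. act y x = 0}"

context short_local_algebra
begin

lemma radical_triple:
  assumes "x \<in> (radical :: 'a set)" "y \<in> radical" "z \<in> radical"
  shows "x * y * z = 0"
proof -
  have "x * y \<in> ideal_mult radical radical"
    unfolding ideal_mult_def using assms by (intro CollectI exI[of _ "[(x, y)]"]) simp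
  then have "x * y * z \<in> ideal_mult (ideal_mult radical radical) radical"
    using assms(3) unfolding ideal_mult_def[of "ideal_mult _ _"]
    by (intro CollectI exI[of _ "[(x * y, z)]"]) simp
  then show ?thesis using radical_cubed by simp
qed

text \<open>
  An element outside the radical is a nonzero scalar times 1 + z with z in J, and 1 + z has the inverse
  1 - z + z^2 because J^3 = 0.
\<close>

lemma left_inverse:
  assumes "a \<notin> (radical :: 'a set)"
  obtains b where "b * a = 1"
proof -
  obtain c y where y: "y \<in> radical" "a = scale c 1 + y" by (rule residue)
  have c: "c \<noteq> 0" using assms y by auto
  let ?z = "scale (inverse c) y"
  have z: "?z \<in> radical" by (rule radical_closed(4)[OF y(1)])
  have "scale (inverse c) a = 1 + ?z" using c by (simp add: y(2) scale_right_distrib)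
  moreover have "(1 - ?z + ?z * ?z) * (1 + ?z) = 1 + ?z * ?z * ?z" by (simp add: algebra_simps)
  ultimately have "(1 - ?z + ?z * ?z) * scale (inverse c) a = 1"
    using radical_triple[OF z z z] by simp
  then show ?thesis using that[of "scale (inverse c) (1 - ?z + ?z * ?z)"]
    by (simp only: scale_mult_left[symmetric] scale_mult_right)
qed

definition rad_square :: "'a set" where
  "rad_square = span {x * y | x y. x \<in> radical \<and> y \<in> radical}"

lemma subspace_rad_square: "subspace rad_square"
  by (simp add: rad_square_def)

lemma rad_square_mult: "x \<in> radical \<Longrightarrow> y \<in> radical \<Longrightarrow> x * y \<in> rad_square"
  unfolding rad_square_def by (rule span_base) blast

lemma rad_square_induct [consumes 1, case_names zero step]:
  assumes "x \<in> rad_square" "P 0"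
    and "\<And>c y z w. y \<in> radical \<Longrightarrow> z \<in> radical \<Longrightarrow> P w \<Longrightarrow> P (scale c (y * z) + w)"
  shows "P x"
  using assms(1) unfolding rad_square_def
  by (induction rule: span_induct_alt) (use assms(2,3) in auto)

lemma radical_mult_rad_square:
  assumes "x \<in> radical" "y \<in> rad_square"
  shows "x * y = 0" "y * x = 0"
proof -
  have "x * y = 0 \<and> y * x = 0" using assms(2)
  proof (induction rule: rad_square_induct)
    case (step c y z w)
    have "x * scale c (y * z) = scale c (x * y * z)" "scale c (y * z) * x = scale c (y * z * x)"
      by (simp_all only: scale_mult_right[symmetric] scale_mult_left[symmetric] mult.assoc)
    then show ?case using step radical_triple assms(1) by (simp add: algebra_simps)
  qed simp
  then show "x * y = 0" "y * x = 0" by auto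
qed

lemma subspace_left_socle: "subspace (left_socle regular_act UNIV)"
  by (auto simp: subspace_def left_socle_def distrib_left simp flip: scale_mult_right)

lemma rad_square_socle: "rad_square \<subseteq> left_socle regular_act UNIV"
  by (auto simp: left_socle_def radical_mult_rad_square)

end

section \<open>Injectivity of the algebra\<close>

context short_local_algebra
begin

text \<open>
  A linear form \<tau> that does not vanish on the simple socle makes A a Frobenius algebra: the pairing
  (a, b) \<mapsto> \<tau> (a b) is nondegenerate, since the left ideal generated by a nonzero b contains the socle.
  So linear forms on A are represented by elements of A, and homomorphisms from a module X to A
  correspond to linear forms on X; but linear forms extend along injections of vector spaces. In this way
  test modules of arbitrary size are treated alike.
\<close>

lemma simple_socle_injective:
  assumes "dim (left_socle regular_act (UNIV :: 'a set)) = 1"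
  shows "injective_module TYPE('x::ab_group_add) TYPE('y::ab_group_add) (regular_act :: 'a \<Rightarrow> 'a \<Rightarrow> 'a)"
proof -
  let ?Soc = "left_socle regular_act (UNIV :: 'a set)"
  interpret K: subspace_dimension "(*) :: 'k \<Rightarrow> 'k \<Rightarrow> 'k"
    by (rule subspace_dimension_field)
  interpret P: subspace_dimension_pair scale "(*) :: 'k \<Rightarrow> 'k \<Rightarrow> 'k" ..
  interpret KT: subspace_dimension "pointwise ((*) :: 'k \<Rightarrow> 'k \<Rightarrow> 'k)"
    by (rule subspace_dimension_pointwise) (rule K.subspace_dimension_axioms)
  interpret Q: subspace_dimension_pair scale "pointwise ((*) :: 'k \<Rightarrow> 'k \<Rightarrow> 'k)" ..
  have soc: "findim ?Soc" by (rule findim_subspaceI[OF subspace_left_socle])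
  obtain z where z: "z \<in> ?Soc" "z \<noteq> 0"
  proof -
    have "?Soc \<noteq> {0}" using assms dim_zero by auto
    then show ?thesis using that subspace_0[OF subspace_left_socle] by blast
  qed
  have "independent {z}" using z(2) by (simp add: dependent_single)
  then obtain \<tau> where lin: "Vector_Spaces.linear scale ((*) :: 'k \<Rightarrow> 'k \<Rightarrow> 'k) \<tau>" and \<tau>z: "\<tau> z = 1"
    using P.linear_independent_extend[of "{z}" "\<lambda>_. 1"] by auto
  interpret \<tau>: Vector_Spaces.linear scale "(*) :: 'k \<Rightarrow> 'k \<Rightarrow> 'k" \<tau> by (rule lin)
  have soc_z: "\<exists>c. b = scale c z" if "b \<in> ?Soc" for b
  proof -
    have "span {z} \<subseteq> ?Soc" using z(1) subspace_left_socle by (intro span_minimal) auto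
    moreover have "dim ?Soc \<le> dim (span {z})"
      using assms dim_pos[OF findim_subspaceI[OF subspace_span] span_base[of z "{z}"] z(2)] by simp
    ultimately have "span {z} = ?Soc" by (intro dim_eq_findim[OF soc subspace_span])
    then show ?thesis using that by (auto simp: span_singleton)
  qed
  have nondegenerate: "b = 0" if b: "\<And>a. \<tau> (a * b) = 0" for b
  proof (rule ccontr)
    assume "b \<noteq> 0"
    \<comment> \<open>If no nonzero multiple of b is in the socle, then multiplying by J three times does not kill b.\<close>
    have no_soc: "c * b \<notin> ?Soc" if "c * b \<noteq> 0" for c
      using soc_z[of "c * b"] b[of c] that \<tau>z by (auto simp: \<tau>.scale)
    from no_soc[of 1] \<open>b \<noteq> 0\<close> obtain y where y: "y \<in> radical" "y * b \<noteq> 0"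
      by (auto simp: left_socle_def)
    from no_soc[OF y(2)] obtain x where "x \<in> radical" "x * (y * b) \<noteq> 0"
      by (auto simp: left_socle_def)
    moreover from this no_soc[of "x * y"] obtain w where "w \<in> radical" "w * (x * y * b) \<noteq> 0"
      by (auto simp: left_socle_def mult.assoc)
    ultimately show False using radical_triple[of w x y] y(1) by (simp flip: mult.assoc)
  qed
  have represent: "\<exists>b. \<forall>a. \<tau> (a * b) = \<phi> a"
    if \<phi>: "Vector_Spaces.linear scale ((*) :: 'k \<Rightarrow> 'k \<Rightarrow> 'k) \<phi>" for \<phi>
  proof -
    obtain B where B: "span B = UNIV" "finite B" "card B = dim UNIV"
      by (rule findim_basis[OF findim_UNIV])
    define n where "n = dim (UNIV :: 'a set)"
    obtain bs where "bij_betw bs {0..<card B} B" using ex_bij_betw_nat_finite[OF B(2)] by blast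
    then have bs: "bs ` {..<n} = B" using B(3) by (simp add: bij_betw_def n_def atLeast0LessThan)
    have eq: "\<psi> = \<chi>" if "Vector_Spaces.linear scale ((*) :: 'k \<Rightarrow> 'k \<Rightarrow> 'k) \<psi>"
      "Vector_Spaces.linear scale ((*) :: 'k \<Rightarrow> 'k \<Rightarrow> 'k) \<chi>" "\<And>i. i < n \<Longrightarrow> \<psi> (bs i) = \<chi> (bs i)" for \<psi> \<chi>
    proof
      fix a
      have "\<psi> b = \<chi> b" if "b \<in> B" for b using that \<open>\<And>i. i < n \<Longrightarrow> \<psi> (bs i) = \<chi> (bs i)\<close> bs by auto
      then show "\<psi> a = \<chi> a" using P.linear_eq_on[OF that(1,2), of a B] B(1) by auto
    qed
    have lin_right: "Vector_Spaces.linear scale ((*) :: 'k \<Rightarrow> 'k \<Rightarrow> 'k) (\<lambda>a. \<tau> (a * b))" for b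
      by unfold_locales (simp_all add: distrib_right \<tau>.add \<tau>.scale flip: scale_mult_left)
    \<comment> \<open>The map from A to its dual space, in coordinates with respect to the basis bs; it is injective.\<close>
    define \<beta> where "\<beta> b = (\<lambda>i. if i < n then \<tau> (bs i * b) else 0)" for b
    have \<beta>: "Vector_Spaces.linear scale (pointwise ((*) :: 'k \<Rightarrow> 'k \<Rightarrow> 'k)) \<beta>"
      by unfold_locales
        (auto simp: \<beta>_def pointwise_def fun_eq_iff distrib_left \<tau>.add \<tau>.scale simp flip: scale_mult_right)
    have "b = 0" if "\<beta> b = 0" for b
    proof -
      have "\<tau> (bs i * b) = 0" if "i < n" for i
        using fun_cong[OF \<open>\<beta> b = 0\<close>, of i] that by (simp add: \<beta>_def)
      then have "(\<lambda>a. \<tau> (a * b)) = (\<lambda>a. \<tau> (a * 0))"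
        by (intro eq[OF lin_right lin_right]) (simp add: \<tau>.zero)
      then show ?thesis using nondegenerate[of b] \<tau>.zero by (metis mult_zero_right)
    qed
    then have "{b \<in> UNIV. \<beta> b = 0} = {0}" using Q.linear_0[OF \<beta>] by auto
    then have dim_\<beta>: "n = KT.dim (range \<beta>)"
      using Q.rank_nullity[OF \<beta> findim_UNIV] dim_zero by (simp add: n_def)
    note K = field_findim_dim[where ?'k = 'k]
    have "range \<beta> = tuples n UNIV"
      using K(2) dim_\<beta> Q.findim_image[OF \<beta> findim_UNIV] K.dim_tuples[OF K(1), of n] KT.findim_subspace
      by (intro KT.dim_eq_findim[OF K.findim_tuples[OF K(1)]]) (auto simp: \<beta>_def tuples_def)
    moreover have "(\<lambda>i. if i < n then \<phi> (bs i) else 0) \<in> tuples n UNIV" by (auto simp: tuples_def)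
    ultimately obtain b where b: "(\<lambda>i. if i < n then \<phi> (bs i) else 0) = \<beta> b" by blast
    have "(\<lambda>a. \<tau> (a * b)) = \<phi>"
    proof (rule eq[OF lin_right \<phi>])
      fix i assume "i < n"
      then show "\<tau> (bs i * b) = \<phi> (bs i)" using fun_cong[OF b, of i] by (simp add: \<beta>_def)
    qed
    then show ?thesis by metis
  qed
  show ?thesis
    unfolding injective_module_def
  proof (intro allI impI)
    fix actX :: "'a \<Rightarrow> 'x \<Rightarrow> 'x" and actY :: "'a \<Rightarrow> 'y \<Rightarrow> 'y" and j f
    assume X: "left_module actX" and Y: "left_module actY"
      and j: "j \<in> lhom actX actY" "inj j" and f: "f \<in> lhom actX regular_act"
    interpret X: left_module actX by fact
    interpret Y: left_module actY by fact
    interpret VX: vector_space "induced_scale actX" by (rule vector_space_induced[OF X])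
    interpret VY: vector_space "induced_scale actY" by (rule vector_space_induced[OF Y])
    interpret XY: vector_space_pair "induced_scale actX" "induced_scale actY" ..
    have "Vector_Spaces.linear (induced_scale actX) (induced_scale actY) j"
      by unfold_locales (use j in \<open>auto simp: hom_on_def induced_scale_def\<close>)
    then obtain r where r: "Vector_Spaces.linear (induced_scale actY) (induced_scale actX) r" "r \<circ> j = id"
      using XY.linear_injective_left_inverse j(2) by blast
    interpret r: Vector_Spaces.linear "induced_scale actY" "induced_scale actX" r by (rule r(1))
    have f_add: "f (x + y) = f x + f y" and f_act: "f (actX a x) = a * f x" for x y a
      using f by (auto simp: hom_on_def)
    have f_scale: "f (induced_scale actX c x) = scale c (f x)" for c x
      by (simp add: induced_scale_def f_act scale_one_mult)
    define \<phi> where "\<phi> y a = \<tau> (f (r (actY a y)))" for y a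
    have "Vector_Spaces.linear scale ((*) :: 'k \<Rightarrow> 'k \<Rightarrow> 'k) (\<phi> y)" for y
    proof unfold_locales
      fix a b :: 'a and c :: 'k
      show "\<phi> y (a + b) = \<phi> y a + \<phi> y b"
        by (simp add: \<phi>_def Y.act_add_left r.add f_add \<tau>.add)
      have "actY (scale c a) y = induced_scale actY c (actY a y)"
        by (simp add: induced_scale_def Y.act_act scale_one_mult)
      then show "\<phi> y (scale c a) = c * \<phi> y a" by (simp add: \<phi>_def r.scale f_scale \<tau>.scale)
    qed
    then have "\<forall>y. \<exists>b. \<forall>a. \<tau> (a * b) = \<phi> y a" by (intro allI represent)
    from choice[OF this] obtain h where h: "\<And>y a. \<tau> (a * h y) = \<phi> y a" by blast
    have unique: "h y = b" if "\<And>a. \<tau> (a * b) = \<phi> y a" for y b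
      using nondegenerate[of "h y - b"] h[of _ y] that by (simp add: right_diff_distrib \<tau>.diff)
    have "h (x + y) = h x + h y" for x y
      by (rule unique) (simp add: distrib_left \<tau>.add h \<phi>_def Y.act_add_right r.add f_add)
    moreover have "h (actY b y) = b * h y" for b y
      by (rule unique) (simp add: h \<phi>_def Y.act_act flip: mult.assoc)
    moreover have "h (j x) = f x" for x
    proof (rule unique)
      fix a
      have "actY a (j x) = j (actX a x)" using j by (simp add: hom_on_def)
      moreover have "r (j y) = y" for y using fun_cong[OF r(2), of y] by simp
      ultimately show "\<tau> (a * f x) = \<phi> (j x) a" by (simp add: \<phi>_def f_act)
    qed
    ultimately show "\<exists>h\<in>lhom actY regular_act. h \<circ> j = f"
      by (intro bexI[of _ h]) (auto simp: hom_on_def)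
  qed
qed

end

lemma free_module_projective:
  fixes act :: "'a::ring_1 \<Rightarrow> 'm::ab_group_add \<Rightarrow> 'm"
  assumes "left_module act" and cov: "covers act n e UNIV" and rel: "relations act n e = {0}"
  shows "projective_module TYPE('x::ab_group_add) TYPE('y::ab_group_add) act"
  unfolding projective_module_def
proof (intro allI impI)
  fix actX :: "'a \<Rightarrow> 'x \<Rightarrow> 'x" and actY :: "'a \<Rightarrow> 'y \<Rightarrow> 'y" and p f
  assume X: "left_module actX" and "left_module actY"
    and p: "p \<in> lhom actX actY" "surj p" and f: "f \<in> lhom act actY"
  interpret M: left_module act by fact
  interpret X: left_module actX by fact
  have "\<forall>l. \<exists>x. p x = f (e l)" using p(2) by (metis surjD)
  then obtain x where x: "\<And>l. p (x l) = f (e l)" by metis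
  have "comb actX n x v = 0" if "v \<in> relations act n e" for v
    using that rel X.comb_zero by simp
  then obtain h where h: "module_map UNIV act UNIV actX h"
    "\<And>v. v \<in> free_carrier n \<Longrightarrow> h (comb act n e v) = comb actX n x v"
    using X.factor_through_cover[OF assms(1) M.submod_UNIV cov X.submod_UNIV, of x] by blast
  have "p (h m) = f m" for m
  proof -
    obtain v where v: "v \<in> free_carrier n" "comb act n e v = m" using coversE[OF cov, of m] by blast
    have "p (h m) = comb actY n (\<lambda>l. p (x l)) v"
      using h(2)[OF v(1)] v(2) module_map_of_comb[OF hom_on_module_map[OF p(1)] X.submod_UNIV, of n x v]
      by simp
    also have "\<dots> = f m"
      using module_map_of_comb[OF hom_on_module_map[OF f] M.submod_UNIV, of n e v] v(2) by (simp add: x)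
    finally show ?thesis .
  qed
  then show "\<exists>h\<in>lhom act actX. p \<circ> h = f"
    using h(1) by (intro bexI[of _ h]) (auto simp: module_map_def hom_on_def)
qed

section \<open>Minimal free resolutions\<close>

text \<open>
  A cover of least rank is minimal: a relation with a coefficient outside the radical, that is, an
  invertible one, expresses one of the generators by the others.
\<close>

lemma (in short_local_algebra) minimal_cover:
  fixes act :: "'a \<Rightarrow> 'm::ab_group_add \<Rightarrow> 'm"
  assumes "left_module act" and cov: "covers act n g X"
  obtains m h where "covers act m h X" "relations act m h \<subseteq> tuples m radical"
proof -
  interpret left_module act by fact
  define m where "m = (LEAST m. \<exists>h. covers act m h X)"
  obtain h where h: "covers act m h X"
    using LeastI_ex[of "\<lambda>m. \<exists>h. covers act m h X"] cov unfolding m_def by blast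
  have "v i \<in> radical" if v: "v \<in> relations act m h" and i: "i < m" for v i
  proof (rule ccontr)
    assume "v i \<notin> radical"
    then obtain b where b: "b * v i = 1" by (rule left_inverse)
    obtain k where k: "m = Suc k" using i by (cases m) auto
    \<comment> \<open>The generator with index i is redundant; the last one takes its place.\<close>
    define h' where "h' = h(i := h k)"
    have "x \<in> comb act k h' ` free_carrier k" if "x \<in> X" for x
    proof -
      obtain c where c: "c \<in> free_carrier m" "comb act m h c = x" by (rule coversE[OF h \<open>x \<in> X\<close>])
      define c' where "c' = c - free_act (c i * b) v"
      have c': "comb act m h c' = x"
        using c v by (simp add: c'_def comb_diff comb_act act_zero_right relations_def)
      have c'i: "c' i = 0" by (simp add: c'_def free_act_def mult.assoc b)
      define c'' where "c'' = (\<lambda>l. if l < k then (if l = i then c' k else c' l) else 0)"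
      have "comb act m h c' = comb act k h' c''"
      proof (cases "i = k")
        case True
        then have "comb act m h c' = (\<Sum>l<k. act (c' l) (h l))"
          using c'i by (simp add: comb_def k act_zero_left)
        also have "\<dots> = comb act k h' c''"
          unfolding comb_def by (rule sum.cong) (auto simp: h'_def c''_def True)
        finally show ?thesis .
      next
        case False
        then have ik: "i \<in> {..<k}" using i k by simp
        have "comb act m h c' = (\<Sum>l\<in>{..<k} - {i}. act (c' l) (h l)) + act (c' k) (h k)"
          using c'i sum.remove[OF finite_lessThan ik, of "\<lambda>l. act (c' l) (h l)"]
          by (simp add: comb_def k act_zero_left)
        also have "(\<Sum>l\<in>{..<k} - {i}. act (c' l) (h l)) = (\<Sum>l\<in>{..<k} - {i}. act (c'' l) (h' l))"
          by (rule sum.cong) (auto simp: h'_def c''_def)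
        also have "act (c' k) (h k) = act (c'' i) (h' i)" using ik by (simp add: h'_def c''_def)
        finally show ?thesis
          using sum.remove[OF finite_lessThan ik, of "\<lambda>l. act (c'' l) (h' l)"]
          by (simp add: comb_def add.commute)
      qed
      moreover have "c'' \<in> free_carrier k" by (auto simp: c''_def free_carrier_def)
      ultimately show ?thesis using c' by blast
    qed
    moreover have "\<forall>l<k. h' l \<in> X" using h k by (auto simp: h'_def covers_def)
    ultimately have "covers act k h' X" by (auto simp: covers_def)
    then have "m \<le> k" unfolding m_def by (intro Least_le) blast
    then show False using k by simp
  qed
  then have "relations act m h \<subseteq> tuples m radical"
    by (auto simp: tuples_def relations_def free_carrier_def)
  then show ?thesis using that h by blast
qed

lemma covers_of_hom_on:
  assumes "f \<in> hom_on (free_carrier n) free_act X act" "f ` free_carrier n = X"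
  shows "covers act n (\<lambda>l. f (unit_vector l)) X"
proof -
  note f = module_map_free_eq_comb[OF hom_on_module_map[OF assms(1)]]
  have "f ` free_carrier n = comb act n (\<lambda>l. f (unit_vector l)) ` free_carrier n"
    by (rule image_cong[OF refl f])
  then have "X \<subseteq> comb act n (\<lambda>l. f (unit_vector l)) ` free_carrier n" using assms(2) by simp
  then show ?thesis using assms(2) unit_vector_free_carrier[of _ n] by (auto simp: covers_def)
qed

lemma (in short_local_algebra) minimal_free_chain:
  fixes act :: "'a \<Rightarrow> 'm::ab_group_add \<Rightarrow> 'm"
  assumes act: "left_module act" and "finite_length act"
  obtains t K e g where "free_chain act t K e g" "\<And>j. K j \<subseteq> tuples (t j) radical"
proof -
  interpret M: left_module act by fact
  note F = left_module_free_act[where ?'a = 'a]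
  obtain n f where "f \<in> hom_on (free_carrier n) free_act UNIV act" "f ` free_carrier n = UNIV"
    using finite_length_span[OF assms] free_cover_exists[OF act M.submod_UNIV] by blast
  then obtain t0 e where e: "covers act t0 e UNIV" "relations act t0 e \<subseteq> tuples t0 radical"
    using minimal_cover[OF act covers_of_hom_on] by blast
  define P :: "nat \<Rightarrow> nat \<times> (nat \<Rightarrow> 'a) set \<Rightarrow> bool" where
    "P j s \<longleftrightarrow> submod free_act (snd s) \<and> snd s \<subseteq> tuples (fst s) radical \<and>
       (j = 0 \<longrightarrow> s = (t0, relations act t0 e))" for j s
  define Q :: "nat \<Rightarrow> nat \<times> (nat \<Rightarrow> 'a) set \<Rightarrow> nat \<times> (nat \<Rightarrow> 'a) set \<Rightarrow> bool" where
    "Q j s s' \<longleftrightarrow> (\<exists>h. covers free_act (fst s') h (snd s) \<and> snd s' = relations free_act (fst s') h)"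
    for j s s'
  have "\<exists>s. \<forall>j. P j (s j) \<and> Q j (s j) (s (Suc j))"
  proof (rule dependent_nat_choice)
    show "\<exists>s. P 0 s"
      using e(2) M.submod_relations by (intro exI[of _ "(t0, relations act t0 e)"]) (simp add: P_def)
  next
    fix s j assume s: "P j s"
    have "snd s \<subseteq> free_carrier (fst s)"
      using s tuples_mono[of radical UNIV] by (auto simp: P_def free_carrier_tuples)
    then obtain T where "finite T" "snd s \<subseteq> module.span (induced_scale free_act) T"
      using free_carrier_span[of "fst s"] by (meson order_trans)
    then obtain n f where "f \<in> hom_on (free_carrier n) free_act (snd s) free_act" "f ` free_carrier n = snd s"
      using free_cover_exists[OF F, of "snd s" T] s by (auto simp: P_def)
    then obtain m h where "covers free_act m h (snd s)" "relations free_act m h \<subseteq> tuples m radical"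
      using minimal_cover[OF F covers_of_hom_on] by blast
    then show "\<exists>s'. P (Suc j) s' \<and> Q j s s'"
      using left_module.submod_relations[OF F]
      by (intro exI[of _ "(m, relations free_act m h)"]) (auto simp: P_def Q_def)
  qed
  then obtain s where s: "\<And>j. P j (s j)" "\<And>j. Q j (s j) (s (Suc j))" by blast
  then have "\<forall>j. \<exists>h. covers free_act (fst (s (Suc j))) h (snd (s j)) \<and>
      snd (s (Suc j)) = relations free_act (fst (s (Suc j))) h" by (simp add: Q_def)
  from choice[OF this] obtain g where "\<And>j. covers free_act (fst (s (Suc j))) (g j) (snd (s j)) \<and>
      snd (s (Suc j)) = relations free_act (fst (s (Suc j))) (g j)" by blast
  then have "free_chain act (\<lambda>j. fst (s j)) (\<lambda>j. snd (s j)) e g"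
    using s(1)[of 0] e(1) by (simp add: free_chain_def P_def)
  moreover have "snd (s j) \<subseteq> tuples (fst (s j)) radical" for j using s(1)[of j] by (simp add: P_def)
  ultimately show ?thesis by (rule that)
qed

lemma free_resolution_chain:
  assumes res: "free_resolution act r d e"
  shows "free_chain act r (\<lambda>j. d j ` free_carrier (r (Suc j))) (\<lambda>l. e (unit_vector l))
           (\<lambda>j l. d j (unit_vector l))"
proof -
  note R = res[unfolded free_resolution_def]
  note e = R[THEN conjunct1] R[THEN conjunct2, THEN conjunct2, THEN conjunct1]
    and d = R[THEN conjunct2, THEN conjunct1, THEN spec]
    and exact = R[THEN conjunct2, THEN conjunct2, THEN conjunct2, THEN conjunct1]
      R[THEN conjunct2, THEN conjunct2, THEN conjunct2, THEN conjunct2, THEN spec]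
  have d': "d j \<in> hom_on (free_carrier (r (Suc j))) free_act (d j ` free_carrier (r (Suc j))) free_act" for j
    using d[of j] by (auto simp: hom_on_def)
  have "relations act (r 0) (\<lambda>l. e (unit_vector l)) = {x \<in> free_carrier (r 0). e x = 0}"
    unfolding relations_def
    by (rule Collect_cong, rule conj_cong[OF refl])
      (simp only: module_map_free_eq_comb[OF hom_on_module_map[OF e(1)], symmetric])
  moreover have "relations free_act (r (Suc j)) (\<lambda>l. d j (unit_vector l)) =
      {x \<in> free_carrier (r (Suc j)). d j x = 0}" for j
    unfolding relations_def
    by (rule Collect_cong, rule conj_cong[OF refl])
      (simp only: module_map_free_eq_comb[OF hom_on_module_map[OF d], symmetric])
  ultimately show ?thesis
    using covers_of_hom_on[OF e] covers_of_hom_on[OF d' refl]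
    by (simp add: free_chain_def exact)
qed

text \<open>
  A homomorphism on the image of d i is the same as a cocycle of degree i + 1, and it extends if and only
  if the cocycle is a coboundary.
\<close>

lemma trivial_Ext_homs_extend:
  assumes act: "left_module act" and res: "free_resolution act r d e" and N: "left_module actN"
    and trivial: "trivial_group (cohomology_group r d actN (Suc i))"
  shows "homs_extend (r i) (d i ` free_carrier (r (Suc i))) UNIV actN"
  unfolding homs_extend_def
proof (intro allI impI)
  let ?F = "\<lambda>j. free_carrier (r j)"
  fix f assume f: "module_map (d i ` ?F (Suc i)) free_act UNIV actN f"
  have d: "d j \<in> hom_on (?F (Suc j)) free_act (?F j) free_act" for j
    using res by (simp add: free_resolution_def)
  have exact: "{x \<in> ?F (Suc i). d i x = 0} = d (Suc i) ` ?F (Suc (Suc i))"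
    using res by (simp add: free_resolution_def)
  note Fc = submod_closed[OF submod_free_carrier[of "r (Suc i)"]]
  have d0: "d i 0 = 0" by (rule module_map_zero[OF hom_on_module_map[OF d] submod_free_carrier])
  have f0: "f 0 = 0"
    using free_chain_submod[OF act free_resolution_chain[OF res], of i] module_map_zero[OF f] by blast
  define f' where "f' v = (if v \<in> ?F (Suc i) then f (d i v) else 0)" for v
  have "f' \<in> hom_on (?F (Suc i)) free_act UNIV actN"
    using f d[of i] Fc(2,3) by (auto simp: hom_on_def module_map_def f'_def)
  moreover have "f' \<circ> d (Suc i) = 0"
  proof
    fix v
    show "(f' \<circ> d (Suc i)) v = 0 v"
    proof (cases "v \<in> ?F (Suc (Suc i))")
      case True
      then have "d i (d (Suc i) v) = 0" using exact by blast
      then show ?thesis by (simp add: f'_def f0)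
    next
      case False
      then have "d (Suc i) v = 0" using d[of "Suc i"] by (simp add: hom_on_def)
      then show ?thesis by (simp add: f'_def d0 f0)
    qed
  qed
  ultimately have "f' \<in> cocycles r d actN (Suc i)" by (simp add: cocycles_def)
  then have "f' \<in> coboundaries r d actN (Suc i)"
    using trivial trivial_cohomology_iff[OF res N, of "Suc i"] by blast
  then obtain h where h: "h \<in> hom_on (?F i) free_act UNIV actN" "f' = h \<circ> d i"
    by (auto simp: coboundaries_def)
  have "comb actN (r i) (\<lambda>l. h (unit_vector l)) x = f x" if "x \<in> d i ` ?F (Suc i)" for x
  proof -
    obtain v where v: "v \<in> ?F (Suc i)" "x = d i v" using \<open>x \<in> d i ` ?F (Suc i)\<close> by blast
    have "x \<in> ?F i" using d[of i] v by (simp add: hom_on_def)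
    then have "comb actN (r i) (\<lambda>l. h (unit_vector l)) x = h x"
      using module_map_free_eq_comb[OF hom_on_module_map[OF h(1)]] by simp
    also have "\<dots> = f x" using fun_cong[OF h(2), of v] v by (simp add: f'_def)
    finally show ?thesis .
  qed
  then show "\<exists>y. (\<forall>l<r i. y l \<in> UNIV) \<and> (\<forall>x\<in>d i ` ?F (Suc i). comb actN (r i) y x = f x)"
    by (intro exI[of _ "\<lambda>l. h (unit_vector l)"]) simp
qed

section \<open>Counting dimensions along a minimal resolution\<close>

lemma (in fd_algebra) induced_scale_regular: "induced_scale regular_act = scale"
  by (simp add: induced_scale_def fun_eq_iff scale_one_mult)

lemma (in fd_algebra) induced_scale_free: "induced_scale free_act = pointwise scale"
  by (simp add: induced_scale_def pointwise_def free_act_def fun_eq_iff scale_one_mult)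

lemma (in fd_algebra) subspace_dimension_induced:
  "left_module act \<Longrightarrow> subspace_dimension (induced_scale act)"
  by (simp add: subspace_dimension_def vector_space_induced)

lemma (in fd_algebra) linear_comb:
  assumes "left_module act"
  shows "Vector_Spaces.linear (pointwise scale) (induced_scale act) (comb act n g)"
proof -
  interpret left_module act by fact
  interpret S: subspace_dimension "pointwise scale"
    by (rule subspace_dimension_pointwise) (rule subspace_dimension_axioms)
  interpret T: subspace_dimension "induced_scale act" by (rule subspace_dimension_induced) fact
  show ?thesis
    by unfold_locales
      (simp_all only: comb_add comb_act induced_scale_def induced_scale_free[symmetric])
qed

text \<open>
  K j is the kernel of the map from the free module of rank t j to the previous one, g j is the tuple of
  minimal generators of K j, and ext_regular expresses that the module resolved is
  semi-Gorenstein-projective.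
\<close>

locale minimal_resolution = short_local_algebra scale
  for scale :: "'k::field \<Rightarrow> 'a::ring_1 \<Rightarrow> 'a" +
  fixes t :: "nat \<Rightarrow> nat" and K :: "nat \<Rightarrow> (nat \<Rightarrow> 'a) set" and g :: "nat \<Rightarrow> nat \<Rightarrow> nat \<Rightarrow> 'a"
  assumes cover: "covers free_act (t (Suc j)) (g j) (K j)"
    and K_Suc: "K (Suc j) = relations free_act (t (Suc j)) (g j)"
    and K_submod: "submod free_act (K j)"
    and K_radical: "K j \<subseteq> tuples (t j) radical"
    and ext_regular: "homs_extend (t j) (K j) UNIV regular_act"
    and K_0: "K 0 \<noteq> {0}"
begin

sublocale V: subspace_dimension "pointwise scale"
  by (rule subspace_dimension_pointwise) (rule subspace_dimension_axioms)

sublocale VV: subspace_dimension_pair "pointwise scale" "pointwise scale" ..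

sublocale F: left_module free_act
  by (rule left_module_free_act)

sublocale R: left_module regular_act
  by unfold_locales (simp_all add: algebra_simps)

abbreviation d where "d j \<equiv> comb free_act (t (Suc j)) (g j)"

lemma linear_d: "Vector_Spaces.linear (pointwise scale) (pointwise scale) (d j)"
  using linear_comb[OF F.left_module_axioms] by (simp only: induced_scale_free)

lemma g_in_K: "l < t (Suc j) \<Longrightarrow> g j l \<in> K j"
  using cover by (simp add: covers_def)

lemma g_radical: "l < t (Suc j) \<Longrightarrow> g j l i \<in> radical"
  using g_in_K K_radical tuples_nth[OF _ radical_closed(1)] by blast

lemma zero_in_K: "0 \<in> K j"
  by (rule submod_closed(1)[OF K_submod])

lemma image_d: "d j ` tuples (t (Suc j)) UNIV = K j"
  using cover[of j] F.comb_in[OF K_submod g_in_K] by (auto simp: covers_def free_carrier_tuples)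

lemma kernel_d: "{v \<in> tuples (t (Suc j)) UNIV. d j v = 0} = K (Suc j)"
  by (simp add: K_Suc relations_def free_carrier_tuples)

lemma kernel_d_radical: "{v \<in> tuples (t (Suc j)) radical. d j v = 0} = K (Suc j)"
  using kernel_d[of j] K_radical[of "Suc j"] tuples_mono[of radical UNIV "t (Suc j)"] by blast

lemma comb_radical_in:
  assumes "v \<in> tuples n (radical :: 'a set)" "\<And>l. l < n \<Longrightarrow> w l \<in> free_carrier m"
  shows "comb free_act n w v \<in> tuples m radical"
proof -
  have "comb free_act n w v \<in> free_carrier m" by (rule F.comb_in[OF submod_free_carrier assms(2)])
  moreover have "comb free_act n w v i \<in> radical" for i
    unfolding comb_coordinate unfolding comb_def using tuples_nth[OF assms(1) radical_closed(1)]
    by (intro submod_sum[OF submod_radical]) (auto intro: radical_mult_right)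
  ultimately show ?thesis by (auto simp: tuples_def free_carrier_def)
qed

text \<open>
  If K (j + 1) = 0, then K j is free on the generators g j, and the projection f to the first
  coordinate extends to the free module of rank t j. But K j lies in the radical of that module, so
  that 1 would be in the radical of A.
\<close>

lemma K_nonzero: "K j \<noteq> {0}"
proof (induction j)
  case (Suc j)
  show ?case
  proof
    assume zero: "K (Suc j) = {0}"
    have "t (Suc j) \<noteq> 0"
    proof
      assume "t (Suc j) = 0"
      then have "tuples (t (Suc j)) (UNIV :: 'a set) = {0}" by (auto simp: tuples_def)
      then have "K j = {d j 0}" using image_d[of j] by (simp only: image_insert image_empty)
      then show False using Suc by (simp only: F.comb_zero)
    qed
    let ?z = "\<lambda>l. if l = 0 then 1 else 0"
    have "comb regular_act (t (Suc j)) ?z v = 0" if "v \<in> relations free_act (t (Suc j)) (g j)" for v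
      using that zero R.comb_zero by (simp flip: K_Suc)
    then obtain f where f: "module_map (K j) free_act UNIV regular_act f"
      "\<And>v. v \<in> free_carrier (t (Suc j)) \<Longrightarrow> f (d j v) = comb regular_act (t (Suc j)) ?z v"
      using R.factor_through_cover[OF F.left_module_axioms K_submod cover[of j] R.submod_UNIV, of ?z] by blast
    obtain y where y: "\<And>x. x \<in> K j \<Longrightarrow> comb regular_act (t j) y x = f x"
      using ext_regular[of j] f(1) unfolding homs_extend_def by blast
    have pos: "0 < t (Suc j)" using \<open>t (Suc j) \<noteq> 0\<close> by simp
    have "f (g j 0) = 1"
      using f(2)[OF unit_vector_free_carrier[OF pos]]
      by (simp add: F.comb_unit[OF pos] R.comb_unit[OF pos])
    then have "comb regular_act (t j) y (g j 0) = 1" using y[OF g_in_K[OF pos]] by simp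
    moreover have "comb regular_act (t j) y (g j 0) \<in> radical"
      unfolding comb_def using g_radical[OF pos]
      by (intro submod_sum[OF submod_radical] radical_mult_right)
    ultimately show False using one_notin_radical by simp
  qed
qed (rule K_0)

lemma t_pos: "0 < t j"
proof (rule ccontr)
  assume "\<not> 0 < t j"
  then have "K j \<subseteq> {0}" using K_radical[of j] by (auto simp: tuples_def fun_eq_iff)
  then show False using K_nonzero[of j] zero_in_K[of j] by blast
qed

text \<open>
The radical of the module K j.
\<close>

abbreviation JK where "JK j \<equiv> d j ` tuples (t (Suc j)) radical"

lemma JK_rad_square: "JK j \<subseteq> tuples (t j) rad_square"
proof (rule image_subsetI)
  fix v assume v: "v \<in> tuples (t (Suc j)) (radical :: 'a set)"
  have "d j v \<in> K j" using image_d[of j] v tuples_mono[of radical UNIV "t (Suc j)"] by blast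
  then have "d j v \<in> tuples (t j) radical" using K_radical by blast
  moreover have "d j v i \<in> rad_square" for i
    unfolding comb_coordinate unfolding comb_def
    using tuples_nth[OF v radical_closed(1)] g_radical
    by (intro subspace_sum[OF subspace_rad_square] rad_square_mult) auto
  ultimately show "d j v \<in> tuples (t j) rad_square" by (simp add: tuples_def)
qed

text \<open>
  The map d j has coefficients in J, and J^3 = 0. The first syzygy K 0 need not have this property.
\<close>

lemma rad_square_in_K: "tuples (t (Suc j)) rad_square \<subseteq> K (Suc j)"
proof
  fix v assume v: "v \<in> tuples (t (Suc j)) rad_square"
  have "d j v i = 0" for i
    unfolding comb_coordinate unfolding comb_def
    using tuples_nth[OF v subspace_0[OF subspace_rad_square]] g_radical
    by (intro sum.neutral) (auto intro: radical_mult_rad_square(2))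
  then have "d j v = 0" by (simp add: fun_eq_iff)
  then show "v \<in> K (Suc j)" using v kernel_d[of j] tuples_mono[of rad_square UNIV] by blast
qed

lemma rad_square_in_socle: "tuples (t (Suc j)) rad_square \<subseteq> left_socle free_act (K (Suc j))"
  using rad_square_in_K[of j] radical_mult_rad_square(1)
    tuples_nth[OF _ subspace_0[OF subspace_rad_square]]
  by (fastforce simp: left_socle_def free_act_def fun_eq_iff)

text \<open>
  Two extremes of homomorphisms from a syzygy X into K j: every z in the socle of K j is the value of
  one at a minimal generator of X, whereas a homomorphism that extends to the free module containing
  X maps X, which lies in the radical, into the radical of K j.
\<close>

lemma socle_subset_JK:
  assumes ext: "homs_extend (t i) (K i) (K j) free_act"
  shows "left_socle free_act (K j) \<subseteq> JK j"
proof
  fix z assume z: "z \<in> left_socle free_act (K j)"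
  let ?n = "t (Suc i)" and ?z = "\<lambda>l. if l = 0 then z else 0"
  have zK: "?z l \<in> K j" for l using z zero_in_K by (simp add: left_socle_def)
  have "comb free_act ?n ?z v = 0" if "v \<in> relations free_act ?n (g i)" for v
  proof -
    have "v l \<in> radical" for l
      using that K_radical[of "Suc i"] K_Suc[of i] tuples_nth[OF _ radical_closed(1)] by blast
    then show ?thesis
      using z unfolding comb_def
      by (intro sum.neutral) (auto simp: left_socle_def F.act_zero_right)
  qed
  then obtain f where f: "module_map (K i) free_act (K j) free_act f"
    "\<And>v. v \<in> free_carrier ?n \<Longrightarrow> f (d i v) = comb free_act ?n ?z v"
    using F.factor_through_cover[OF F.left_module_axioms K_submod cover[of i] K_submod, of ?z j] zK by blast
  obtain y where y: "\<And>l. l < t i \<Longrightarrow> y l \<in> K j" "\<And>x. x \<in> K i \<Longrightarrow> comb free_act (t i) y x = f x"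
    using ext f(1) unfolding homs_extend_def by blast
  obtain w where w: "\<And>l. l < t i \<Longrightarrow> w l \<in> free_carrier (t (Suc j))" "\<And>l. l < t i \<Longrightarrow> d j (w l) = y l"
    using covers_choose[OF cover[of j], of "t i" y] y(1) by blast
  note pos = t_pos[of "Suc i"]
  have "z = f (g i 0)"
    using f(2)[OF unit_vector_free_carrier[OF pos]] by (simp add: F.comb_unit[OF pos])
  also have "\<dots> = comb free_act (t i) y (g i 0)" using y(2)[OF g_in_K[OF pos]] by simp
  also have "\<dots> = comb free_act (t i) (\<lambda>l. d j (w l)) (g i 0)" by (rule F.comb_cong) (simp add: w(2))
  also have "\<dots> = d j (comb free_act (t i) w (g i 0))" by (simp only: F.comb_comb)
  finally have "z = d j (comb free_act (t i) w (g i 0))" .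
  moreover have "comb free_act (t i) w (g i 0) \<in> tuples (t (Suc j)) radical"
    by (rule comb_radical_in[OF subsetD[OF K_radical g_in_K[OF pos]] w(1)])
  ultimately show "z \<in> JK j" by (rule image_eqI)
qed

abbreviation dim_rad where "dim_rad \<equiv> dim (radical :: 'a set)"
abbreviation dim_square where "dim_square \<equiv> dim rad_square"

lemma dim_free:
  assumes "subspace S"
  shows "V.findim (tuples n S)" "V.dim (tuples n S) = n * dim S"
  using findim_tuples dim_tuples findim_subspaceI[OF assms] by auto

lemma findim_K: "V.findim (K j)"
  using VV.findim_image[OF linear_d[of j] dim_free(1)[OF subspace_UNIV, of "t (Suc j)"]]
  by (simp only: image_d)

lemma dim_K_Suc: "V.dim (K j) + V.dim (K (Suc j)) = Suc dim_rad * t (Suc j)"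
  using VV.rank_nullity[OF linear_d[of j] dim_free(1)[OF subspace_UNIV, of "t (Suc j)"]]
  unfolding image_d kernel_d dim_free(2)[OF subspace_UNIV] by (simp add: dim_radical mult.commute)

lemma dim_JK: "V.dim (JK j) + V.dim (K (Suc j)) = dim_rad * t (Suc j)"
  using VV.rank_nullity[OF linear_d[of j] dim_free(1)[OF subspace_radical, of "t (Suc j)"]]
  unfolding kernel_d_radical dim_free(2)[OF subspace_radical] by (simp add: mult.commute)

text \<open>
  The last summand is the dimension of the top of K j, by minimality of the resolution.
\<close>

lemma dim_K: "V.dim (K j) = V.dim (JK j) + t (Suc j)"
  using dim_K_Suc[of j] dim_JK[of j] by simp


text \<open>
  The differential of the complex of homomorphisms from the resolution to a module, where a
  homomorphism from a free module is the tuple of its values at the unit vectors.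
\<close>

definition delta :: "('a \<Rightarrow> 'm::ab_group_add \<Rightarrow> 'm) \<Rightarrow> nat \<Rightarrow> (nat \<Rightarrow> 'm) \<Rightarrow> (nat \<Rightarrow> 'm)" where
  "delta act l y = (\<lambda>i. if i < t (Suc l) then comb act (t l) y (g l i) else 0)"

definition kernel_dim :: "('a \<Rightarrow> 'm::ab_group_add \<Rightarrow> 'm) \<Rightarrow> 'm set \<Rightarrow> nat \<Rightarrow> nat" where
  "kernel_dim act N l =
     vector_space.dim (pointwise (induced_scale act)) {y \<in> tuples (t l) N. delta act l y = 0}"

lemma linear_delta:
  assumes "left_module act"
  shows "Vector_Spaces.linear (pointwise (induced_scale act)) (pointwise (induced_scale act)) (delta act l)"
proof -
  interpret left_module act by fact
  interpret T: subspace_dimension "induced_scale act" by (rule subspace_dimension_induced) fact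
  interpret TT: subspace_dimension "pointwise (induced_scale act)"
    by (rule subspace_dimension_pointwise) (rule T.subspace_dimension_axioms)
  have "comb act n (x + y) v = comb act n x v + comb act n y v" for n x y v
    using comb_add_tuple[of n x y v] by (simp add: plus_fun_def)
  moreover have "comb act n (pointwise (induced_scale act) r y) v = induced_scale act r (comb act n y v)"
    for n r y v
  proof -
    have "b * scale r 1 = scale r 1 * b" for b
      by (simp add: scale_one_mult flip: scale_mult_right)
    then show ?thesis by (simp add: comb_def pointwise_def induced_scale_def act_sum act_act)
  qed
  ultimately show ?thesis
    by unfold_locales (auto simp: delta_def fun_eq_iff pointwise_def)
qed

lemma submod_subspace:
  assumes "left_module act" "submod act S"
  shows "module.subspace (induced_scale act) S"
proof -
  interpret T: subspace_dimension "induced_scale act" by (rule subspace_dimension_induced) fact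
  show ?thesis using submod_closed[OF assms(2)] by (simp add: T.subspace_def induced_scale_def)
qed

lemma delta_socle:
  assumes act: "left_module act" and S: "\<forall>x\<in>radical. \<forall>s\<in>S. act x s = 0"
    and y: "y \<in> tuples (t l) S"
  shows "delta act l y = 0"
proof
  fix i
  have "comb act (t l) y (g l i) = 0" if "i < t (Suc l)"
    unfolding comb_def using S g_radical[OF that] y by (intro sum.neutral) (auto simp: tuples_def)
  then show "delta act l y i = 0 i" by (simp add: delta_def)
qed

lemma kernel_subset_image:
  assumes act: "left_module act" and N: "submod act N" and ext: "homs_extend (t l) (K l) N act"
  shows "{y \<in> tuples (t (Suc l)) N. delta act (Suc l) y = 0} \<subseteq> delta act l ` tuples (t l) N"
proof
  fix z assume z: "z \<in> {y \<in> tuples (t (Suc l)) N. delta act (Suc l) y = 0}"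
  then have z0: "delta act (Suc l) z = 0" by simp
  have cocycle: "comb act (t (Suc l)) z (g (Suc l) i) = 0" if "i < t (Suc (Suc l))" for i
    using fun_cong[OF z0, of i] that by (simp add: delta_def)
  have zN: "z i \<in> N" if "i < t (Suc l)" for i using z that by (simp add: tuples_def)
  obtain y where y: "\<And>i. i < t l \<Longrightarrow> y i \<in> N"
      "\<And>i. i < t (Suc l) \<Longrightarrow> comb act (t l) y (g l i) = z i"
    by (rule left_module.cocycle_is_coboundary[OF act ext N K_submod cover[of l]
        cover[of "Suc l", unfolded K_Suc], of z]) (use zN cocycle in \<open>blast intro: that\<close>)+
  define y' where "y' i = (if i < t l then y i else 0)" for i
  have "delta act l y' i = z i" for i
  proof (cases "i < t (Suc l)")
    case True
    have "comb act (t l) y' (g l i) = comb act (t l) y (g l i)"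
      by (rule left_module.comb_cong[OF act]) (simp add: y'_def)
    then show ?thesis using True y(2) by (simp add: delta_def)
  next
    case False
    then show ?thesis using z by (simp add: delta_def tuples_def)
  qed
  then have "z = delta act l y'" by (simp add: fun_eq_iff)
  moreover have "y' \<in> tuples (t l) N" using y(1) by (simp add: tuples_def y'_def)
  ultimately show "z \<in> delta act l ` tuples (t l) N" by blast
qed

text \<open>
  The last three bounds hold because the differentials have coefficients in J: they vanish on tuples
  in a semisimple submodule S of N, and when J N is contained in S, their rank is at most the
  dimension of the power of S in the next term.
\<close>

lemma kernel_dim_bounds:
  assumes act: "left_module act" and N: "submod act N"
    and fin: "subspace_dimension.findim (induced_scale act) N"
  shows kernel_dim_exact: "homs_extend (t l) (K l) N act \<Longrightarrow>
      kernel_dim act N (Suc l) + kernel_dim act N l \<le> t l * vector_space.dim (induced_scale act) N"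
    and kernel_dim_socle: "submod act S \<Longrightarrow> S \<subseteq> N \<Longrightarrow>
      (\<forall>x\<in>radical. \<forall>s\<in>S. act x s = 0) \<Longrightarrow>
      t l * vector_space.dim (induced_scale act) S \<le> kernel_dim act N l"
    and kernel_dim_socle_strict: "submod act S \<Longrightarrow> S \<subseteq> N \<Longrightarrow>
      (\<forall>x\<in>radical. \<forall>s\<in>S. act x s = 0) \<Longrightarrow>
      y \<in> tuples (t l) N \<Longrightarrow> delta act l y = 0 \<Longrightarrow> y \<notin> tuples (t l) S \<Longrightarrow>
      t l * vector_space.dim (induced_scale act) S < kernel_dim act N l"
    and kernel_dim_radical: "submod act S \<Longrightarrow> S \<subseteq> N \<Longrightarrow>
      (\<And>y. y \<in> tuples (t l) N \<Longrightarrow> delta act l y \<in> tuples (t (Suc l)) S) \<Longrightarrow>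
      t l * vector_space.dim (induced_scale act) N \<le>
        kernel_dim act N l + t (Suc l) * vector_space.dim (induced_scale act) S"
proof -
  interpret T: subspace_dimension "induced_scale act" by (rule subspace_dimension_induced) fact
  interpret TT: subspace_dimension "pointwise (induced_scale act)"
    by (rule subspace_dimension_pointwise) (rule T.subspace_dimension_axioms)
  interpret P: subspace_dimension_pair "pointwise (induced_scale act)" "pointwise (induced_scale act)" ..
  let ?ker = "\<lambda>l. {y \<in> tuples (t l) N. delta act l y = 0}"
  note tN = T.findim_tuples[OF fin] T.dim_tuples[OF fin]
  note lin = linear_delta[OF act]
  have fin_ker: "TT.findim (?ker l)" for l by (rule P.findim_kernel[OF lin tN(1)])
  have rn: "t l * T.dim N = TT.dim (delta act l ` tuples (t l) N) + kernel_dim act N l" for l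
    using P.rank_nullity[OF lin[of l] tN(1)[of "t l"]] unfolding tN(2) kernel_dim_def .
  show "kernel_dim act N (Suc l) + kernel_dim act N l \<le> t l * T.dim N"
    if "homs_extend (t l) (K l) N act"
  proof -
    have "kernel_dim act N (Suc l) \<le> TT.dim (delta act l ` tuples (t l) N)"
      unfolding kernel_dim_def
      by (rule TT.dim_mono_findim[OF P.findim_image[OF lin tN(1)] TT.findim_subspace[OF fin_ker]
            kernel_subset_image[OF act N that]])
    then show ?thesis using rn[of l] by simp
  qed
  have finS: "T.findim S" if "submod act S" "S \<subseteq> N" for S
    by (rule T.findim_mono[OF fin submod_subspace[OF act that(1)] that(2)])
  have S_ker: "tuples (t l) S \<subseteq> ?ker l"
    if "S \<subseteq> N" "\<forall>x\<in>radical. \<forall>s\<in>S. act x s = 0" for S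
  proof
    fix y assume "y \<in> tuples (t l) S"
    then show "y \<in> ?ker l" using delta_socle[OF act that(2), where y = y and l = l] tuples_mono[OF that(1), of "t l"] by auto
  qed
  show le: "t l * T.dim S \<le> kernel_dim act N l"
    if S: "submod act S" "S \<subseteq> N" "\<forall>x\<in>radical. \<forall>s\<in>S. act x s = 0"
    using TT.dim_mono_findim[OF fin_ker TT.findim_subspace[OF T.findim_tuples[OF finS[OF S(1,2)]]]
        S_ker[OF S(2,3)]] T.dim_tuples[OF finS[OF S(1,2)]]
    by (simp add: kernel_dim_def)
  show "t l * T.dim S < kernel_dim act N l"
    if S: "submod act S" "S \<subseteq> N" "\<forall>x\<in>radical. \<forall>s\<in>S. act x s = 0"
      and y: "y \<in> tuples (t l) N" "delta act l y = 0" "y \<notin> tuples (t l) S"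
  proof (rule ccontr)
    assume "\<not> t l * T.dim S < kernel_dim act N l"
    then have "tuples (t l) S = ?ker l"
      using T.dim_tuples[OF finS[OF S(1,2)], of "t l"]
      by (intro TT.dim_eq_findim[OF fin_ker TT.findim_subspace[OF T.findim_tuples[OF finS[OF S(1,2)]]]
          S_ker[OF S(2,3)]]) (simp_all add: kernel_dim_def)
    then show False using y by blast
  qed
  show "t l * T.dim N \<le> kernel_dim act N l + t (Suc l) * T.dim S"
    if S: "submod act S" "S \<subseteq> N"
      and im: "\<And>y. y \<in> tuples (t l) N \<Longrightarrow> delta act l y \<in> tuples (t (Suc l)) S"
  proof -
    have "TT.dim (delta act l ` tuples (t l) N) \<le> TT.dim (tuples (t (Suc l)) S)"
      using im by (intro TT.dim_mono_findim[OF T.findim_tuples[OF finS[OF S]]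
            TT.findim_subspace[OF P.findim_image[OF lin tN(1)]]]) blast
    then show ?thesis using rn[of l] T.dim_tuples[OF finS[OF S], of "t (Suc l)"] by simp
  qed
qed

end

section \<open>Self-extensions do not vanish\<close>

text \<open>
  With E = c - a, which is positive, and p = a x1 x3, the third bound on \<kappa> becomes
  E (x2^2 - p) + (a^2 - a) x1 x2 + p \<le> \<kappa> after the elimination of x4 and c. As p < x2^2, the left hand
  side is at least x2^2.
\<close>

lemma rank_arithmetic:
  fixes x1 x2 x3 x4 a c \<kappa> :: nat
  assumes dim_rel: "c * x2 = a * x1 + a * x2 + x3" "c * x3 = a * x2 + a * x3 + x4"
    and \<kappa>: "\<kappa> < x2 * x2" "a * x1 * x3 \<le> \<kappa>" "x3 * (a * x1 + x2) \<le> \<kappa> + x4 * (a * x1)"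
    and "0 < x2" "0 < x3"
  shows False
proof -
  define E where "E = int c - int a"
  define X1 X2 X3 X4 A where XA: "X1 = int x1" "X2 = int x2" "X3 = int x3" "X4 = int x4" "A = int a"
  define P where "P = A * X1 * X3"
  have r: "E * X2 = A * X1 + X3" "E * X3 = A * X2 + X4"
    using dim_rel[THEN arg_cong[where f = int]] by (simp_all add: E_def XA algebra_simps)
  have k: "int \<kappa> < X2 * X2" "P \<le> int \<kappa>" "X3 * (A * X1 + X2) \<le> int \<kappa> + X4 * (A * X1)"
    using \<kappa> unfolding P_def XA of_nat_mult[symmetric] of_nat_add[symmetric] by linarith+
  have "0 < E * X2" using r(1) assms(6,7) by (simp add: XA add_nonneg_pos)
  then have E: "1 \<le> E" using assms(6) by (simp add: XA zero_less_mult_iff)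
  have X4: "X4 = E * X3 - A * X2" and X3: "X3 = E * X2 - A * X1" using r by simp_all
  have "X3 * X2 = E * (X2 * X2) - A * X1 * X2" by (subst X3) (simp add: algebra_simps)
  moreover have "X4 * (A * X1) = E * P - A * A * X1 * X2"
    unfolding X4 P_def by (simp add: algebra_simps)
  moreover have "X3 * (A * X1 + X2) = P + X3 * X2" by (simp add: P_def algebra_simps)
  ultimately have "P + (E * (X2 * X2) - A * X1 * X2) \<le> int \<kappa> + (E * P - A * A * X1 * X2)"
    using k(3) by simp
  then have "P + E * (X2 * X2 - P) + (A * A - A) * (X1 * X2) \<le> int \<kappa>" by (simp add: algebra_simps)
  moreover have "X2 * X2 - P \<le> E * (X2 * X2 - P)"
    using mult_right_mono[OF E, of "X2 * X2 - P"] k by simp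
  moreover have "0 \<le> (A * A - A) * (X1 * X2)"
  proof -
    have "a \<le> a * a" by (cases a) auto
    then have "int a \<le> int (a * a)" by (rule of_nat_mono)
    then have "A \<le> A * A" by (simp add: XA)
    then show ?thesis by (intro mult_nonneg_nonneg) (simp_all add: XA)
  qed
  ultimately show False using k(1) by linarith
qed

lemma no_infinite_descent:
  fixes f :: "nat \<Rightarrow> nat"
  assumes "\<And>j. m \<le> j \<Longrightarrow> f (Suc j) < f j"
  shows False
proof -
  have "f (m + n) + n \<le> f m" for n
  proof (induction n)
    case (Suc n)
    then show ?case using assms[of "m + n"] by simp
  qed simp
  from this[of "Suc (f m)"] show False by simp
qed

context minimal_resolution
begin

text \<open>
  J^2 F is contained in K (j + 1) and annihilated by J, so it lies in the socle of K (j + 1). This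
  determines all dimensions below.
\<close>

lemma JK_eq_rad_square:
  assumes "homs_extend (t i) (K i) (K (Suc j)) free_act"
  shows "JK (Suc j) = tuples (t (Suc j)) rad_square"
  using socle_subset_JK[OF assms] rad_square_in_socle JK_rad_square by blast

lemma dim_K_aligned:
  assumes "JK (Suc j) = tuples (t (Suc j)) rad_square"
  shows "V.dim (K (Suc j)) = dim_square * t (Suc j) + t (Suc (Suc j))"
  unfolding dim_K assms dim_free(2)[OF subspace_rad_square] by simp

lemma submod_rad_square: "submod free_act (tuples n rad_square)"
proof -
  have "b * x \<in> rad_square" if x: "x \<in> rad_square" for b x
  proof -
    obtain r y where y: "y \<in> radical" "b = scale r 1 + y" by (rule residue)
    have "b * x = scale r x" using radical_mult_rad_square(1)[OF y(1) x]
      by (simp add: y(2) distrib_right scale_one_mult)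
    then show ?thesis using subspace_scale[OF subspace_rad_square x] by simp
  qed
  then show ?thesis
    using subspace_0[OF subspace_rad_square] subspace_add[OF subspace_rad_square]
    by (auto simp: submod_def tuples_def free_act_def)
qed

lemma rad_square_killed: "\<forall>x\<in>radical. \<forall>s\<in>tuples n rad_square. free_act x s = 0"
  using radical_mult_rad_square(1) tuples_nth[OF _ subspace_0[OF subspace_rad_square]]
  by (auto simp: free_act_def fun_eq_iff)

lemma delta_into_JK:
  assumes y: "y \<in> tuples (t l) (K j)"
  shows "delta free_act l y \<in> tuples (t (Suc l)) (JK j)"
proof -
  obtain w where w: "\<And>m. m < t l \<Longrightarrow> w m \<in> free_carrier (t (Suc j))" "\<And>m. m < t l \<Longrightarrow> d j (w m) = y m"
    using covers_choose[OF cover[of j], of "t l" y] y by (auto simp: tuples_def)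
  have "comb free_act (t l) y (g l i) \<in> JK j" if "i < t (Suc l)" for i
  proof -
    have "comb free_act (t l) y (g l i) = comb free_act (t l) (\<lambda>m. d j (w m)) (g l i)"
      by (rule F.comb_cong) (simp add: w(2))
    also have "\<dots> = d j (comb free_act (t l) w (g l i))" by (simp only: F.comb_comb)
    finally have "comb free_act (t l) y (g l i) = d j (comb free_act (t l) w (g l i))" .
    moreover have "comb free_act (t l) w (g l i) \<in> tuples (t (Suc j)) radical"
      by (rule comb_radical_in[OF subsetD[OF K_radical g_in_K[OF that]] w(1)])
    ultimately show ?thesis by (rule image_eqI)
  qed
  then show ?thesis by (simp add: tuples_def delta_def)
qed

lemma findim_K_induced: "subspace_dimension.findim (induced_scale free_act) (K j)"
  using findim_K by (simp only: induced_scale_free)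

text \<open>
  The general bounds for N = K (j + 1), with J N = J^2 F in both roles of S.
\<close>

lemma aligned_kernel_bounds:
  assumes aligned: "JK (Suc j) = tuples (t (Suc j)) rad_square"
  defines "N \<equiv> K (Suc j)"
  shows "homs_extend (t l) (K l) N free_act \<Longrightarrow> kernel_dim free_act N (Suc l) + kernel_dim free_act N l
           \<le> t l * (dim_square * t (Suc j) + t (Suc (Suc j)))"
    and "t l * (dim_square * t (Suc j)) \<le> kernel_dim free_act N l"
    and "y \<in> tuples (t l) N \<Longrightarrow> delta free_act l y = 0 \<Longrightarrow> y \<notin> tuples (t l) (tuples (t (Suc j)) rad_square) \<Longrightarrow>
           t l * (dim_square * t (Suc j)) < kernel_dim free_act N l"
    and "t l * (dim_square * t (Suc j) + t (Suc (Suc j)))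
           \<le> kernel_dim free_act N l + t (Suc l) * (dim_square * t (Suc j))"
proof -
  note B = kernel_dim_bounds[OF F.left_module_axioms K_submod[of "Suc j"] findim_K_induced[of "Suc j"],
      unfolded induced_scale_free, folded N_def]
  have N: "V.dim N = dim_square * t (Suc j) + t (Suc (Suc j))"
    unfolding N_def by (rule dim_K_aligned[OF aligned])
  have S: "V.dim (tuples (t (Suc j)) rad_square) = dim_square * t (Suc j)"
    using dim_free(2)[OF subspace_rad_square] by simp
  note T = submod_rad_square[of "t (Suc j)"] rad_square_in_K[of j, folded N_def]
  note kill = rad_square_killed[of "t (Suc j)"]
  show "homs_extend (t l) (K l) N free_act \<Longrightarrow> kernel_dim free_act N (Suc l) + kernel_dim free_act N l
           \<le> t l * (dim_square * t (Suc j) + t (Suc (Suc j)))"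
    using B(1)[of l] unfolding N .
  show "t l * (dim_square * t (Suc j)) \<le> kernel_dim free_act N l"
    using B(2)[OF T kill, of l] unfolding S .
  show "y \<in> tuples (t l) N \<Longrightarrow> delta free_act l y = 0 \<Longrightarrow> y \<notin> tuples (t l) (tuples (t (Suc j)) rad_square) \<Longrightarrow>
           t l * (dim_square * t (Suc j)) < kernel_dim free_act N l"
    using B(3)[OF T kill, of y l] unfolding S .
  show "t l * (dim_square * t (Suc j) + t (Suc (Suc j)))
           \<le> kernel_dim free_act N l + t (Suc l) * (dim_square * t (Suc j))"
  proof -
    have "delta free_act l y \<in> tuples (t (Suc l)) (tuples (t (Suc j)) rad_square)"
      if "y \<in> tuples (t l) N" for y
      using delta_into_JK[of y l "Suc j"] that unfolding aligned N_def .
    from B(4)[OF T this] show ?thesis unfolding S N .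
  qed
qed

text \<open>
  The kernel of the differential with index l + 1 is at most as large as the rank of the one with index
  l, and both kernels contain the tuples with entries in J^2 F.
\<close>

lemma ranks_inequality:
  assumes "JK (Suc j) = tuples (t (Suc j)) rad_square" "homs_extend (t l) (K l) (K (Suc j)) free_act"
  shows "dim_square * t (Suc j) * t (Suc l) \<le> t l * t (Suc (Suc j))"
  using aligned_kernel_bounds(1)[OF assms] aligned_kernel_bounds(2)[OF assms(1), of l]
    aligned_kernel_bounds(2)[OF assms(1), of "Suc l"]
  by (simp add: algebra_simps)

lemma ranks_recurrence:
  assumes "JK (Suc j) = tuples (t (Suc j)) rad_square"
    "JK (Suc (Suc j)) = tuples (t (Suc (Suc j))) rad_square"
  shows "dim_rad * t (Suc (Suc j)) =
    dim_square * t (Suc j) + dim_square * t (Suc (Suc j)) + t (Suc (Suc (Suc j)))"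
  using dim_K_Suc[of "Suc j"] dim_K_aligned[OF assms(1)] dim_K_aligned[OF assms(2)] by simp

text \<open>
  Take N = K 1. The kernel with index 3 has dimension \<kappa>. It contains the tuples with entries in J N, and
  its codimension is a rank, at most the dimension of the space of such tuples in the next term. It is
  contained in the image of the differential with index 2, whose kernel is strictly larger than the
  space of tuples with entries in J N.
\<close>

lemma ext_one_contradiction:
  assumes ext: "\<And>j. homs_extend (t (Suc j)) (K (Suc j)) (K j) free_act"
  shows False
proof -
  have al: "JK (Suc j) = tuples (t (Suc j)) rad_square" for j
    by (rule JK_eq_rad_square[OF ext])
  let ?N = "K 1"
  \<comment> \<open>The free cover of K 1, which is a cocycle with values outside J K 1.\<close>
  define y where "y m = (if m < t 2 then g 1 m else 0)" for m
  have y: "y \<in> tuples (t 2) ?N" using g_in_K[of _ 1] by (simp add: y_def tuples_def numeral_2_eq_2)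
  have "comb free_act (t 2) y (g 2 i) = 0" if "i < t 3" for i
  proof -
    have "g 2 i \<in> K (Suc 1)" using g_in_K[of i 2] that by (simp add: numeral_2_eq_2 numeral_3_eq_3)
    then have "d 1 (g 2 i) = 0" using K_Suc[of 1] by (simp only: relations_def mem_Collect_eq)
    moreover have "comb free_act (t 2) y (g 2 i) = comb free_act (t 2) (g 1) (g 2 i)"
      by (rule F.comb_cong) (simp add: y_def)
    ultimately show ?thesis by (simp add: numeral_2_eq_2)
  qed
  then have y0: "delta free_act 2 y = 0" by (simp add: delta_def fun_eq_iff numeral_2_eq_2 numeral_3_eq_3)
  have ynot: "y \<notin> tuples (t 2) (tuples (t 1) rad_square)"
  proof
    assume asm: "y \<in> tuples (t 2) (tuples (t 1) rad_square)"
    have "g 1 m \<in> tuples (t 1) rad_square" if "m < t (Suc 1)" for m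
      using asm that by (simp add: y_def tuples_def numeral_2_eq_2)
    then have "K 1 \<subseteq> tuples (t 1) rad_square"
      using F.comb_in[OF submod_rad_square] cover[of 1] unfolding covers_def by blast
    then have "V.dim (K 1) \<le> V.dim (tuples (t 1) rad_square)"
      by (rule V.dim_mono_findim[OF dim_free(1)[OF subspace_rad_square] V.findim_subspace[OF findim_K]])
    then show False
      using dim_K_aligned[OF al[of 0]] t_pos[of 2] dim_free(2)[OF subspace_rad_square, of "t 1"]
      by (simp add: numeral_2_eq_2)
  qed
  define \<kappa> where "\<kappa> = kernel_dim free_act ?N 3"
  define p where "p = dim_square * t 1 * t 3"
  have "kernel_dim free_act ?N 3 + kernel_dim free_act ?N 2 \<le> t 2 * (dim_square * t 1 + t 2)"
    using aligned_kernel_bounds(1)[OF al[of 0], of 2] ext[of 1] by (simp add: numeral_2_eq_2 numeral_3_eq_3)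
  moreover have "t 2 * (dim_square * t 1) < kernel_dim free_act ?N 2"
    using aligned_kernel_bounds(3)[OF al[of 0], of y 2] y y0 ynot by (simp add: numeral_2_eq_2)
  ultimately have "\<kappa> < t 2 * t 2" unfolding \<kappa>_def by (simp add: algebra_simps)
  moreover have "p \<le> \<kappa>"
    using aligned_kernel_bounds(2)[OF al[of 0], of 3] unfolding \<kappa>_def p_def
    by (simp add: algebra_simps)
  moreover have "t 3 * (dim_square * t 1 + t 2) \<le> \<kappa> + t 4 * (dim_square * t 1)"
    using aligned_kernel_bounds(4)[OF al[of 0], of 3] unfolding \<kappa>_def
    by (simp add: numeral_2_eq_2 eval_nat_numeral)
  moreover have "dim_rad * t 2 = dim_square * t 1 + dim_square * t 2 + t 3"
    "dim_rad * t 3 = dim_square * t 2 + dim_square * t 3 + t 4"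
    using ranks_recurrence[OF al al, of 0] ranks_recurrence[OF al al, of 1]
    by (simp_all add: eval_nat_numeral)
  ultimately show False
    using rank_arithmetic[of dim_rad "t 2" dim_square "t 1" "t 3" "t 4" \<kappa>] t_pos[of 2] t_pos[of 3]
    by (simp add: p_def)
qed

text \<open>
  Let \<sigma> be the dimension of the left socle of A. All homomorphisms from K l to the socle are
  restrictions of homomorphisms from the free module of rank t l to A, given by tuples in A. Tuples
  with entries in J only give values in J^2, and they have codimension t l. Hence
  \<sigma> t (l + 1) \<le> a t (l + 1) + t l. If \<sigma> > a, then the ranks never increase, so that equality holds for
  some l. Then every homomorphism from the free module to A maps K l to the socle, that is, K l has its
  entries in the socle, and J K l = 0, although J K l = J^2 F is not zero.
\<close>

lemma left_socle_eq_rad_square: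
  assumes aligned: "\<And>j. JK (Suc j) = tuples (t (Suc j)) rad_square" and pos: "0 < dim_square"
  shows "left_socle regular_act UNIV = rad_square"
proof (rule ccontr)
  let ?Soc = "left_socle regular_act (UNIV :: 'a set)"
  assume neq: "?Soc \<noteq> rad_square"
  have less: "dim_square < dim ?Soc"
  proof (rule ccontr)
    assume "\<not> dim_square < dim ?Soc"
    then have "rad_square = ?Soc"
      by (intro dim_eq_findim[OF findim_subspaceI[OF subspace_left_socle] subspace_rad_square
            rad_square_socle]) simp
    then show False using neq by simp
  qed
  let ?I = "\<lambda>l. delta regular_act l ` tuples (t l) UNIV"
  have lin: "Vector_Spaces.linear (pointwise scale) (pointwise scale) (delta regular_act l)" for l
    using linear_delta[OF R.left_module_axioms] by (simp only: induced_scale_regular)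
  note U = dim_free[OF subspace_UNIV] and J = dim_free[OF subspace_radical]
    and S = dim_free[OF subspace_left_socle] and Q = dim_free[OF subspace_rad_square]
  have fin_I: "V.findim (?I l)" for l by (rule VV.findim_image[OF lin U(1)])
  have sub: "tuples (t (Suc l)) ?Soc \<subseteq> ?I l" for l
  proof -
    have "tuples (t (Suc l)) ?Soc \<subseteq> {y \<in> tuples (t (Suc l)) UNIV. delta regular_act (Suc l) y = 0}"
      using delta_socle[OF R.left_module_axioms, of ?Soc] tuples_mono[of ?Soc UNIV]
      by (auto simp: left_socle_def)
    also have "\<dots> \<subseteq> ?I l"
      by (rule kernel_subset_image[OF R.left_module_axioms R.submod_UNIV ext_regular])
    finally show ?thesis .
  qed
  have lower: "t (Suc l) * dim ?Soc \<le> V.dim (?I l)" for l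
    using V.dim_mono_findim[OF fin_I V.findim_subspace[OF S(1)] sub] unfolding S(2) .
  have upper: "V.dim (?I l) \<le> t l + t (Suc l) * dim_square" for l
  proof -
    let ?ker = "\<lambda>S. {y \<in> tuples (t l) S. delta regular_act l y = 0}"
    have "delta regular_act l ` tuples (t l) radical \<subseteq> tuples (t (Suc l)) rad_square"
      unfolding delta_def comb_def using g_radical
      by (auto simp: tuples_def intro!: subspace_sum[OF subspace_rad_square] rad_square_mult)
    then have "V.dim (delta regular_act l ` tuples (t l) radical) \<le> t (Suc l) * dim_square"
      using V.dim_mono_findim[OF Q(1) V.findim_subspace[OF VV.findim_image[OF lin J(1)]]]
      unfolding Q(2) by blast
    moreover have "V.dim (?ker radical) \<le> V.dim (?ker UNIV)"
      using tuples_mono[of radical UNIV "t l"]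
      by (intro V.dim_mono_findim[OF VV.findim_kernel[OF lin U(1)]
            V.findim_subspace[OF VV.findim_kernel[OF lin J(1)]]]) auto
    moreover have "t l * Suc dim_rad = V.dim (?I l) + V.dim (?ker UNIV)"
      using VV.rank_nullity[OF lin[of l] U(1)[of "t l"]] unfolding U(2) dim_radical .
    moreover have "t l * dim_rad = V.dim (delta regular_act l ` tuples (t l) radical) + V.dim (?ker radical)"
      using VV.rank_nullity[OF lin[of l] J(1)[of "t l"]] unfolding J(2) .
    ultimately show ?thesis by simp
  qed
  have step: "t (Suc l) * Suc dim_square \<le> V.dim (?I l)" for l
    using lower[of l] mult_le_mono2[of "Suc dim_square" "dim ?Soc" "t (Suc l)"] less by linarith
  have le: "t (Suc l) \<le> t l" for l using step[of l] upper[of l] by simp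
  obtain l where l: "0 < l" "t (Suc l) = t l"
    using no_infinite_descent[of 1 t] le le_neq_implies_less by (metis less_le_trans zero_less_one)
  have "tuples (t (Suc l)) ?Soc = ?I l"
  proof (rule V.dim_eq_findim[OF fin_I V.findim_subspace[OF S(1)] sub])
    have "V.dim (?I l) \<le> t (Suc l) * Suc dim_square" using upper[of l] l(2) by simp
    also have "\<dots> \<le> t (Suc l) * dim ?Soc" using less by (intro mult_le_mono2) simp
    finally show "V.dim (?I l) \<le> V.dim (tuples (t (Suc l)) ?Soc)" unfolding S(2) .
  qed
  then have I: "?I l \<subseteq> tuples (t (Suc l)) ?Soc" by simp
  have entry: "g l i q \<in> ?Soc" if i: "i < t (Suc l)" and q: "q < t l" for i q
  proof -
    have "unit_vector q \<in> tuples (t l) (UNIV :: 'a set)"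
      using unit_vector_free_carrier[OF q] by (simp add: free_carrier_tuples)
    then have "delta regular_act l (unit_vector q) \<in> tuples (t (Suc l)) ?Soc" using I by blast
    then have "comb regular_act (t l) (unit_vector q) (g l i) \<in> ?Soc" using i by (simp add: delta_def tuples_def)
    moreover have "comb regular_act (t l) (unit_vector q) (g l i) = (\<Sum>m<t l. if m = q then g l i m else 0)"
      unfolding comb_def by (rule sum.cong) (auto simp: unit_vector_def)
    ultimately show ?thesis using q by simp
  qed
  have "JK l \<subseteq> {0}"
  proof (rule image_subsetI)
    fix v assume v: "v \<in> tuples (t (Suc l)) (radical :: 'a set)"
    have "v m * g l m q = 0" if m: "m < t (Suc l)" for m q
    proof (cases "q < t l")
      case True
      then show ?thesis using entry[OF m True] v m by (auto simp: left_socle_def tuples_def)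
    next
      case False
      then have "g l m q = 0" using g_in_K[OF m] K_radical[of l] by (auto simp: tuples_def)
      then show ?thesis by simp
    qed
    then have "d l v q = 0" for q
      unfolding comb_coordinate unfolding comb_def by (intro sum.neutral) simp
    then show "d l v \<in> {0}" by (simp add: fun_eq_iff)
  qed
  moreover obtain l' where l': "l = Suc l'" using l(1) gr0_conv_Suc by blast
  ultimately have "V.dim (tuples (t l) rad_square) \<le> V.dim {0}"
    using aligned[of l'] by (intro V.dim_mono_findim[OF V.findim_zero V.findim_subspace[OF Q(1)]]) simp
  then show False using pos t_pos[of l] by (simp add: Q(2) V.dim_zero)
qed

text \<open>
  When a \<ge> 2, the quotient t (j + 1) / t j at least halves if j increases by i, and it is bounded by
  dim J; so it is eventually less than 1, and the ranks would decrease forever.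
\<close>

lemma ext_contradiction:
  assumes i: "0 < i" and ext: "\<And>j. homs_extend (t (i + j)) (K (i + j)) (K j) free_act"
    and not_injective: "\<not> injective_module TYPE('x::ab_group_add) TYPE('y::ab_group_add)
      (regular_act :: 'a \<Rightarrow> 'a \<Rightarrow> 'a)"
  shows False
proof -
  have aligned: "JK (Suc j) = tuples (t (Suc j)) rad_square" for j
    by (rule JK_eq_rad_square[OF ext])
  \<comment> \<open>If J has square zero, then K 1 is semisimple and its radical is zero.\<close>
  have pos: "0 < dim_square"
  proof (rule ccontr)
    assume dim_zero: "\<not> 0 < dim_square"
    have zero: "x = 0" if "x \<in> rad_square" for x
      using dim_pos[OF findim_subspaceI[OF subspace_rad_square] that] dim_zero by blast
    have "x * v m = 0" if x: "x \<in> radical" and v: "v \<in> K 1" for x v m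
    proof -
      have "v m \<in> radical"
        by (rule tuples_nth[OF subsetD[OF K_radical v] radical_closed(1)])
      then show ?thesis by (rule zero[OF rad_square_mult[OF x]])
    qed
    then have "K 1 \<subseteq> left_socle free_act (K 1)"
      by (auto simp: left_socle_def free_act_def fun_eq_iff)
    also have "\<dots> \<subseteq> tuples (t 1) rad_square"
      using socle_subset_JK[OF ext[of 1]] aligned[of 0] by simp
    also have "\<dots> \<subseteq> {0}" using zero by (auto simp: tuples_def fun_eq_iff) (metis not_less)
    finally show False using K_nonzero[of 1] zero_in_K[of 1] by blast
  qed
  have "dim_square \<noteq> 1"
  proof
    assume "dim_square = 1"
    then have "dim (left_socle regular_act (UNIV :: 'a set)) = 1"
      by (simp only: left_socle_eq_rad_square[OF aligned pos])
    from simple_socle_injective[OF this] not_injective show False by blast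
  qed
  then have two: "2 \<le> dim_square" using pos by simp
  have bound: "t (Suc j) \<le> dim_rad * t j" if "2 \<le> j" for j
  proof -
    obtain j' where j': "j = 2 + j'" using le_Suc_ex[OF \<open>2 \<le> j\<close>] by blast
    show ?thesis using ranks_recurrence[OF aligned aligned, of j'] by (simp add: j')
  qed
  have decay: "2 ^ n * t (Suc j) \<le> dim_rad * t j" if "2 + n * i \<le> j" for n j
    using that
  proof (induction n arbitrary: j)
    case 0
    then show ?case using bound by simp
  next
    case (Suc n)
    define k where "k = j - i"
    have k: "j = i + k" "2 + n * i \<le> k" using Suc.prems by (auto simp: k_def)
    obtain k' where k': "k = Suc k'" using k(2) by (cases k) auto
    have "2 * t k * t (Suc j) \<le> dim_square * t k * t (Suc j)" using two by simp
    also have "\<dots> \<le> t j * t (Suc k)"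
      using ranks_inequality[OF aligned[of k'], of "i + k"] ext[of k] by (simp add: k(1) k')
    finally have "2 ^ n * (2 * t k * t (Suc j)) \<le> 2 ^ n * (t j * t (Suc k))" by simp
    also have "\<dots> = t j * (2 ^ n * t (Suc k))" by simp
    also have "\<dots> \<le> t j * (dim_rad * t k)" by (rule mult_le_mono2[OF Suc.IH[OF k(2)]])
    finally have "t k * (2 ^ Suc n * t (Suc j)) \<le> t k * (dim_rad * t j)" by (simp add: ac_simps)
    then show ?case using t_pos[of k] by simp
  qed
  show False
  proof (rule no_infinite_descent[of "2 + dim_rad * i" t])
    fix j assume "2 + dim_rad * i \<le> j"
    then have "2 ^ dim_rad * t (Suc j) \<le> dim_rad * t j" by (rule decay)
    also have "\<dots> < 2 ^ dim_rad * t j" using t_pos[of j] by (simp add: less_exp)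
    finally show "t (Suc j) < t j" by simp
  qed
qed

end

theorem theorem1p5:
  fixes scale :: "'k::field \<Rightarrow> 'a::ring_1 \<Rightarrow> 'a"
    and act :: "'a \<Rightarrow> 'm::ab_group_add \<Rightarrow> 'm"
  assumes "short_local_algebra scale"
    and "left_module act" and "finite_length act"
    and "\<not> projective_module TYPE('p::ab_group_add) TYPE('q::ab_group_add) act"
    and "semi_Gorenstein_projective act"
  shows "\<not> trivial_group (Ext_group 1 act act) \<and>
    (\<not> injective_module TYPE('x::ab_group_add) TYPE('y::ab_group_add) (regular_act :: 'a \<Rightarrow> 'a \<Rightarrow> 'a)
      \<longrightarrow> (\<forall>i\<ge>1. \<not> trivial_group (Ext_group i act act)))"
proof -
  interpret A: short_local_algebra scale by fact
  interpret M: left_module act by fact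
  interpret F: left_module "free_act :: 'a \<Rightarrow> _" by (rule left_module_free_act)
  obtain r d where rd: "chosen_resolution act = (r, d)" by (cases "chosen_resolution act")
  obtain e where res: "free_resolution act r d e"
    using A.chosen_resolution_free_resolution[OF assms(2,3) rd] by blast
  obtain t K e' g where chain: "free_chain act t K e' g" and min: "\<And>j. K j \<subseteq> tuples (t j) radical"
    by (rule A.minimal_free_chain[OF assms(2,3)]) blast
  note sub = free_chain_submod[OF assms(2) chain]
  have extend: "homs_extend (t i) (K i) UNIV actN"
    if N: "left_module actN" and trivial: "trivial_group (Ext_group (Suc i) act actN)"
    for actN :: "'a \<Rightarrow> 'n::ab_group_add \<Rightarrow> 'n" and i
  proof -
    have "trivial_group (cohomology_group r d actN (Suc i))" using trivial rd by (simp add: Ext_group_def)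
    then have "homs_extend (r i) (d i ` free_carrier (r (Suc i))) UNIV actN"
      by (rule trivial_Ext_homs_extend[OF assms(2) res N])
    then show ?thesis
      using homs_extend_transfer[OF N left_module.submod_UNIV[OF N]
          free_chains_stably_related[OF assms(2) free_resolution_chain[OF res] chain] sub]
      by blast
  qed
  have cov: "covers act (t 0) e' UNIV" "K 0 = relations act (t 0) e'"
    "\<And>j. covers free_act (t (Suc j)) (g j) (K j)" "\<And>j. K (Suc j) = relations free_act (t (Suc j)) (g j)"
    using chain by (auto simp: free_chain_def)
  have K0: "K 0 \<noteq> {0}"
    using free_module_projective[OF assms(2) cov(1)] assms(4) cov(2) by metis
  have regular: "left_module (regular_act :: 'a \<Rightarrow> 'a \<Rightarrow> 'a)"
    by unfold_locales (simp_all add: algebra_simps)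
  have ext_regular: "homs_extend (t j) (K j) UNIV regular_act" for j
    using extend[OF regular] assms(5) by (simp add: semi_Gorenstein_projective_def)
  interpret minimal_resolution scale t K g
    by unfold_locales (use cov(3,4) sub min ext_regular K0 in auto)
  have shift: "homs_extend (t (Suc i + j)) (K (Suc i + j)) (K j) free_act"
    if "trivial_group (Ext_group (Suc i) act act)" for i j
  proof (induction j)
    case 0
    show ?case
      using M.homs_extend_shift[OF M.submod_UNIV cov(1) sub cov(3) extend[OF assms(2) that],
          folded cov(2,4)] ext_regular by simp
  next
    case (Suc j)
    show ?case
      using F.homs_extend_shift[OF sub cov(3) sub cov(3) Suc, folded cov(4)] ext_regular by simp
  qed
  have "\<not> trivial_group (Ext_group 1 act act)"
    using shift[of 0] ext_one_contradiction by auto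
  moreover have "\<not> trivial_group (Ext_group i act act)"
    if inj: "\<not> injective_module TYPE('x::ab_group_add) TYPE('y::ab_group_add) (regular_act :: 'a \<Rightarrow> 'a \<Rightarrow> 'a)"
      and i: "1 \<le> i" for i
  proof
    assume trivial: "trivial_group (Ext_group i act act)"
    obtain i' where i': "i = Suc i'" using i by (cases i) auto
    show False
      by (rule ext_contradiction[OF _ shift[of i'] inj]) (use trivial i' in auto)
  qed
  ultimately show ?thesis by blast
qed

end
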